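(* Let $d,r$ be integers with $1\le d<q$ and $1\le r\le\binom{m+d}{d}-r_d$. Then there is an integer $e_0$ such that for all $e\ge e_0$ and all $\mathcal{S}\subseteq\overline{\mathbb{M}}_d$ with $|\mathcal{S}|=r$, $$|\Delta_e(\mathcal{S})|\le|\Delta_e(\mathcal{M}_d(r))|.$$ Consequently, $A_r(d,m;e)=|\Delta_e(\mathcal{M}_d(r))|$ and $\overline{e}_r(d,m)\le|\Delta_e(\mathcal{M}_d(r))|$ for all sufficiently large $e$.
   Context: Let $q$ be a prime power, $\mathbb{F}_q$ the finite field with $q$ elements, $m$ a positive integer. A monomial $\mu\neq 1$ in $x_0,\dots,x_m$ can be written $\mu=x_0^{a_0}\cdots x_\ell^{a_\ell}$ with $0\le\ell\le m$, $a_\ell>0$; it is projectively reduced if $a_0,\dots,a_{\ell-1}\le q-1$; $1$ is also projectively reduced. A polynomial is projectively reduced if it is an $\mathbb{F}_q$-linear combination of projectively reduced monomials. $\overline{\mathbb{M}}_e$ denotes the set of projectively reduced monomials of degree $e$. $r_d$ is the $\mathbb{F}_q$-dimension of the degree-$d$ homogeneous component of the ideal of $\mathbb{F}_q[x_0,\dots,x_m]$ generated by $\{x_i^qx_j-x_ix_j^q:0\le i<j\le m\}$ (one has $|\overline{\mathbb{M}}_d|=\binom{m+d}{d}-r_d$, and $r_d=0$ for $d\le q$). For a set $\mathcal{S}$ of monomials, $\nabla_e(\mathcal{S})=\{\mu\in\overline{\mathbb{M}}_e:\nu\mid\mu\text{ for some }\nu\in\mathcal{S}\}$ and $\Delta_e(\mathcal{S})=\overline{\mathbb{M}}_e\setminus\nabla_e(\mathcal{S})$.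 $A_r(d,m;e)=\max\{|\Delta_e(\mathcal{S})|:\mathcal{S}\subseteq\overline{\mathbb{M}}_d,|\mathcal{S}|=r\}$. Lexicographic order: $x_0^{b_0}\cdots x_m^{b_m}\prec x_0^{a_0}\cdots x_m^{a_m}$ iff at the first index where exponents differ, $a_i>b_i$. $\mathcal{M}_d(r)$ is the set of the first $r$ elements of $\overline{\mathbb{M}}_d$ in descending lexicographic order. $\overline{e}_r(d,m)$ is the maximum of the number of points of $\mathbb{P}^m(\mathbb{F}_q)$ at which $G_1,\dots,G_r$ all vanish, over all families of $r$ linearly independent projectively reduced homogeneous polynomials $G_1,\dots,G_r$ of degree $d$ in $\mathbb{F}_q[x_0,\dots,x_m]$. *)

theory Defs
  imports Main
begin

text \<open>Monomials in x_0..x_m are exponent vectors a :: nat => nat with a i = 0 for i > m.\<close>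

definition mdeg :: "nat \<Rightarrow> (nat \<Rightarrow> nat) \<Rightarrow> nat" where
  "mdeg m a = (\<Sum>i\<le>m. a i)"

definition proj_reduced :: "nat \<Rightarrow> nat \<Rightarrow> (nat \<Rightarrow> nat) \<Rightarrow> bool" where
  "proj_reduced q m a \<longleftrightarrow> (\<forall>i. a i = 0) \<or>
     (\<exists>l\<le>m. 0 < a l \<and> (\<forall>i>l. a i = 0) \<and> (\<forall>i<l. a i \<le> q - 1))"

definition Mbar :: "nat \<Rightarrow> nat \<Rightarrow> nat \<Rightarrow> (nat \<Rightarrow> nat) set" where
  "Mbar q m e = {a. (\<forall>i>m. a i = 0) \<and> mdeg m a = e \<and> proj_reduced q m a}"

definition mdvd :: "(nat \<Rightarrow> nat) \<Rightarrow> (nat \<Rightarrow> nat) \<Rightarrow> bool" where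
  "mdvd \<nu> \<mu> \<longleftrightarrow> (\<forall>i. \<nu> i \<le> \<mu> i)"

definition nabla :: "nat \<Rightarrow> nat \<Rightarrow> nat \<Rightarrow> (nat \<Rightarrow> nat) set \<Rightarrow> (nat \<Rightarrow> nat) set" where
  "nabla q m e S = {\<mu> \<in> Mbar q m e. \<exists>\<nu>\<in>S. mdvd \<nu> \<mu>}"

definition Delta :: "nat \<Rightarrow> nat \<Rightarrow> nat \<Rightarrow> (nat \<Rightarrow> nat) set \<Rightarrow> (nat \<Rightarrow> nat) set" where
  "Delta q m e S = Mbar q m e - nabla q m e S"

definition A_r :: "nat \<Rightarrow> nat \<Rightarrow> nat \<Rightarrow> nat \<Rightarrow> nat \<Rightarrow> nat" where
  "A_r q r d m e = Max {card (Delta q m e S) | S. S \<subseteq> Mbar q m d \<and> card S = r}"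

definition lex_less :: "(nat \<Rightarrow> nat) \<Rightarrow> (nat \<Rightarrow> nat) \<Rightarrow> bool" where
  "lex_less b a \<longleftrightarrow> (\<exists>i. (\<forall>j<i. a j = b j) \<and> b i < a i)"

text \<open>The first r elements of Mbar_d in descending lexicographic order:
  those elements having fewer than r elements of Mbar_d strictly above them.\<close>
definition lexM :: "nat \<Rightarrow> nat \<Rightarrow> nat \<Rightarrow> nat \<Rightarrow> (nat \<Rightarrow> nat) set" where
  "lexM q m d r = {a \<in> Mbar q m d. card {b \<in> Mbar q m d. lex_less a b} < r}"

text \<open>Polynomials over a field 'a are coefficient functions on exponent vectors.
  A projectively reduced homogeneous polynomial of degree d is one whose support
  lies in Mbar q m d.\<close>
definition peval :: "nat \<Rightarrow> nat \<Rightarrow> nat \<Rightarrow> ((nat \<Rightarrow> nat) \<Rightarrow> 'a::field) \<Rightarrow> (nat \<Rightarrow> 'a) \<Rightarrow> 'a" where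
  "peval q m d G x = (\<Sum>a\<in>Mbar q m d. G a * (\<Prod>i\<le>m. x i ^ a i))"

definition proj_points :: "nat \<Rightarrow> (nat \<Rightarrow> 'a::field) set set" where
  "proj_points m = {{(\<lambda>i. c * x i) | c. c \<noteq> 0} | x.
       (\<forall>i>m. x i = 0) \<and> (\<exists>i\<le>m. x i \<noteq> 0)}"

definition common_zeros :: "nat \<Rightarrow> nat \<Rightarrow> nat \<Rightarrow> nat \<Rightarrow> (nat \<Rightarrow> (nat \<Rightarrow> nat) \<Rightarrow> 'a::field)
    \<Rightarrow> (nat \<Rightarrow> 'a) set set" where
  "common_zeros q m d r G = {P \<in> proj_points m. \<forall>x\<in>P. \<forall>j<r. peval q m d (G j) x = 0}"

definition admissible_family :: "nat \<Rightarrow> nat \<Rightarrow> nat \<Rightarrow> nat \<Rightarrow> (nat \<Rightarrow> (nat \<Rightarrow> nat) \<Rightarrow> 'a::field) \<Rightarrow> bool" where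
  "admissible_family q m d r G \<longleftrightarrow>
     (\<forall>j<r. \<forall>a. a \<notin> Mbar q m d \<longrightarrow> G j a = 0) \<and>
     (\<forall>c. (\<forall>a. (\<Sum>j<r. c j * G j a) = 0) \<longrightarrow> (\<forall>j<r. c j = 0))"

definition ebar :: "'a::{finite,field} itself \<Rightarrow> nat \<Rightarrow> nat \<Rightarrow> nat \<Rightarrow> nat" where
  "ebar _ r d m = Max ((\<lambda>G :: nat \<Rightarrow> (nat \<Rightarrow> nat) \<Rightarrow> 'a. card (common_zeros (card (UNIV :: 'a set)) m d r G))
       ` {G. admissible_family (card (UNIV :: 'a set)) m d r G})"

end

theory Submission
  imports Defs "HOL-Library.FuncSet"
begin

text \<open>Compressing a set \<open>S\<close> of monomials of degree \<open>d < q\<close> along adjacent variables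
  \<open>x\<^sub>i, x\<^sub>i\<^sub>+\<^sub>1\<close> does not change its size and does not enlarge \<open>\<nabla>\<^sub>e(S)\<close>, so \<open>S\<close> may be assumed
  strongly stable. Then \<open>\<nabla>\<^sub>e(S)\<close> is the disjoint union over \<open>\<nu> \<in> S\<close> of the reduced monomials
  whose first \<open>d\<close> letters form \<open>\<nu>\<close>, and for large \<open>e\<close> the size of the piece of \<open>\<nu>\<close> is a decreasing
  function of the pair \<open>(p, \<nu>\<^sub>p)\<close>, ordered lexicographically, where \<open>x\<^sub>p\<close> is the last variable
  of \<open>\<nu>\<close>. By Macaulay's theorem for strongly stable sets (a result of Bayer), among the
  strongly stable sets of a given size the lexicographic segment has the fewest elements below
  any given pair, hence the smallest \<open>\<nabla>\<^sub>e\<close>.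

  For the bound on common zeros, the leading monomials of the span of the given polynomials
  contain a set \<open>S\<close> of size \<open>r\<close>, and division by these polynomials and by
  \<open>x\<^sub>i\<^sup>q x\<^sub>j - x\<^sub>i x\<^sub>j\<^sup>q\<close> shows that the monomials in \<open>\<Delta>\<^sub>e(S)\<close> span all functions on the set of
  common zeros. Dimensions are compared by counting elements over the finite field.\<close>

text \<open>The obstacle is that reducedness caps exponents in degree e. The reduced monomials on a
  line form a truncated interval, possibly with one far point, so it is not clear that pushing S
  towards x_0 cannot create multiples. The hypothesis d < q enters twice here: every monomial of
  degree d is then reduced, so compression stays among admissible sets, and a line of degree-d
  monomials has total exponent n < q, which makes the counting on truncated intervals come out right
  (\<open>card_interval_chain\<close>). Large e serves two purposes. The exponents before the last
  variable x_l of a reduced monomial are below q, so once e > m*q they can be prescribed freely and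
  the exponent of x_l is the positive remainder. This gives the piece of \<nu> exactly 1 + (q-c)(1 +
  q + ... + q^(m-p-1)) elements, where c = \<nu>_p. The same bound leaves enough degree to separate
  any two points of the projective space by forms of degree e. Only the order of the piece sizes
  matters: a sum of weights is compared through its superlevel sets, and these are cut out by bounds
  on the pair (p, c).\<close>

definition mons :: "nat \<Rightarrow> nat \<Rightarrow> (nat \<Rightarrow> nat) set" where
  "mons m d = {a. (\<forall>i>m. a i = 0) \<and> mdeg m a = d}"

text \<open>\<open>LEAST\<close> yields 0 on the zero vector, so the variable with index
  \<open>mx a\<close> really occurs in every monomial except 1.\<close>

definition mx :: "(nat \<Rightarrow> nat) \<Rightarrow> nat" where
  "mx a = (LEAST p. \<forall>i>p. a i = 0)"

text \<open>Only adjacent moves are required, because these are what compression delivers;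
  \<open>stable_move\<close> composes them into moves from any x_j to any earlier x_i.\<close>

definition strongly_stable :: "(nat \<Rightarrow> nat) set \<Rightarrow> bool" where
  "strongly_stable S \<longleftrightarrow> (\<forall>a\<in>S. \<forall>i. 0 < a (Suc i) \<longrightarrow> a(i := a i + 1, Suc i := a (Suc i) - 1) \<in> S)"

definition lexseg :: "nat \<Rightarrow> nat \<Rightarrow> (nat \<Rightarrow> nat) set \<Rightarrow> bool" where
  "lexseg m d L \<longleftrightarrow> L \<subseteq> mons m d \<and> (\<forall>a\<in>L. \<forall>b\<in>mons m d. lex_less a b \<longrightarrow> b \<in> L)"

lemma mons_le: "a \<in> mons m d \<Longrightarrow> a i \<le> d"
proof (cases "i \<le> m")
  case True
  assume "a \<in> mons m d"
  then show ?thesis using True member_le_sum[of i "{..m}" a] by (auto simp: mons_def mdeg_def)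
next
  case False
  assume "a \<in> mons m d"
  then show ?thesis using False by (auto simp: mons_def)
qed

lemma mons_pos_le: "a \<in> mons m d \<Longrightarrow> 0 < a i \<Longrightarrow> i \<le> m"
  by (rule ccontr) (auto simp: mons_def)

lemma finite_mons: "finite (mons m d)"
proof -
  have "mons m d \<subseteq> (\<lambda>f i. if i \<le> m then f i else 0) ` ({..m} \<rightarrow>\<^sub>E {..d})"
  proof
    fix a assume a: "a \<in> mons m d"
    then have "a = (\<lambda>i. if i \<le> m then restrict a {..m} i else 0)"
      by (auto simp: mons_def fun_eq_iff)
    moreover have "restrict a {..m} \<in> {..m} \<rightarrow>\<^sub>E {..d}" using mons_le[OF a] by auto
    ultimately show "a \<in> (\<lambda>f i. if i \<le> m then f i else 0) ` ({..m} \<rightarrow>\<^sub>E {..d})" by blast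
  qed
  then show ?thesis by (rule finite_subset) (auto intro!: finite_PiE)
qed

lemma finite_mons_subset: "S \<subseteq> mons m d \<Longrightarrow> finite S"
  using finite_mons finite_subset by blast

lemma lexseg_finite: "lexseg m d L \<Longrightarrow> finite L"
  unfolding lexseg_def using finite_mons_subset by blast

text \<open>A proper divisor has strictly smaller degree.\<close>

lemma mons_eqI:
  assumes "a \<in> mons m d" "b \<in> mons m d" "\<And>i. a i \<le> b i"
  shows "a = b"
proof (rule ccontr)
  assume "a \<noteq> b"
  then obtain i where i: "a i \<noteq> b i" by blast
  have im: "i \<le> m" using i mons_pos_le[OF assms(1)] mons_pos_le[OF assms(2)] by (metis not_gr_zero)
  have "(\<Sum>i\<le>m. a i) < (\<Sum>i\<le>m. b i)"
    by (rule sum_strict_mono_ex1) (use assms(3) i im in \<open>auto intro!: bexI[of _ i] simp: nat_less_le\<close>)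
  then show False using assms(1,2) by (simp add: mons_def mdeg_def)
qed

section \<open>The lexicographic order\<close>

lemma lex_less_irrefl: "\<not> lex_less a a"
  by (auto simp: lex_less_def)

lemma lex_less_trans:
  assumes "lex_less a b" "lex_less b c"
  shows "lex_less a c"
proof -
  obtain i where i: "\<forall>k<i. b k = a k" "a i < b i" using assms(1) by (auto simp: lex_less_def)
  obtain j where j: "\<forall>k<j. c k = b k" "b j < c j" using assms(2) by (auto simp: lex_less_def)
  have "(\<forall>k<min i j. c k = a k) \<and> a (min i j) < c (min i j)"
    using i j by (cases i j rule: linorder_cases) (auto simp: min_def)
  then show ?thesis unfolding lex_less_def by blast
qed

lemma lex_less_total:
  assumes "a \<noteq> b"
  shows "lex_less a b \<or> lex_less b a"
proof -
  define i where "i = (LEAST i. a i \<noteq> b i)"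
  have "\<exists>i. a i \<noteq> b i" using assms by blast
  then have "a i \<noteq> b i" unfolding i_def by (rule LeastI_ex)
  moreover have "\<forall>k<i. a k = b k" unfolding i_def using not_less_Least by blast
  ultimately show ?thesis by (auto simp: lex_less_def) (metis linorder_neqE_nat)
qed

text \<open>The rank is the count used in \<open>lexM\<close>. It decreases strictly along the
  order, hence is injective with values below \<open>card A\<close>, so "fewer than r above" selects
  exactly r elements.\<close>

lemma lex_rank_bij:
  assumes "finite A"
  shows "bij_betw (\<lambda>a. card {b\<in>A. lex_less a b}) A {..<card A}"
proof -
  let ?r = "\<lambda>a. card {b\<in>A. lex_less a b}"
  have less: "?r b < ?r a" if "lex_less a b" "a \<in> A" "b \<in> A" for a b
  proof (rule psubset_card_mono)
    have "b \<in> {b\<in>A. lex_less a b}" "b \<notin> {c\<in>A. lex_less b c}" using that lex_less_irrefl by auto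
    then show "{c\<in>A. lex_less b c} \<subset> {b\<in>A. lex_less a b}" using that lex_less_trans by blast
  qed (use assms in simp)
  have inj: "inj_on ?r A"
  proof (rule inj_onI, rule ccontr)
    fix a b assume "a \<in> A" "b \<in> A" and eq: "?r a = ?r b" and "a \<noteq> b"
    then have "?r a < ?r b \<or> ?r b < ?r a" using lex_less_total less by blast
    with eq show False by simp
  qed
  have "?r ` A \<subseteq> {..<card A}"
    using assms lex_less_irrefl by (auto intro!: psubset_card_mono)
  moreover have "card (?r ` A) = card {..<card A}" using inj by (simp add: card_image)
  ultimately have "?r ` A = {..<card A}" by (simp add: card_subset_eq)
  with inj show ?thesis by (simp add: bij_betw_def)
qed

lemma card_lex_first:
  assumes "finite A" "r \<le> card A"
  shows "card {a\<in>A. card {b\<in>A. lex_less a b} < r} = r"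
proof -
  let ?r = "\<lambda>a. card {b\<in>A. lex_less a b}"
  have im: "?r ` A = {..<card A}" using lex_rank_bij[OF assms(1)] by (simp add: bij_betw_def)
  have "{..<r} \<subseteq> ?r ` A" unfolding im using assms(2) by auto
  then have "?r ` {a\<in>A. ?r a < r} = {..<r}" by auto
  then have "bij_betw ?r {a\<in>A. ?r a < r} {..<r}"
    by (intro bij_betw_subset[OF lex_rank_bij[OF assms(1)]]) auto
  then show ?thesis by (simp add: bij_betw_same_card)
qed

lemma lexseg_first: "lexseg m d {a\<in>mons m d. card {b\<in>mons m d. lex_less a b} < r}"
proof -
  have "card {c \<in> mons m d. lex_less b c} \<le> card {c \<in> mons m d. lex_less a c}"
    if "lex_less a b" for a b
  proof (rule card_mono)
    show "{c \<in> mons m d. lex_less b c} \<subseteq> {c \<in> mons m d. lex_less a c}"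
      using that lex_less_trans by blast
  qed (simp add: finite_mons)
  then show ?thesis unfolding lexseg_def by (auto intro: le_less_trans)
qed

lemma lexseg_exists:
  assumes "r \<le> card (mons m d)"
  obtains L where "lexseg m d L" "card L = r"
  using lexseg_first card_lex_first[OF finite_mons assms] that by blast

text \<open>Upper sets of a total order are nested, and \<open>a\<close> decides the
  direction.\<close>

lemma lexseg_comparable:
  assumes "lexseg m d K" "lexseg m d L" "a \<in> K" "a \<notin> L"
  shows "L \<subset> K"
proof -
  have "b \<in> K" if "b \<in> L" for b
    using assms that lex_less_total[of a b] unfolding lexseg_def by (metis subsetD)
  then show ?thesis using assms by blast
qed

lemma lexseg_card_le:
  assumes "lexseg m d K" "lexseg m d L" "card L \<le> card K"
  shows "L \<subseteq> K"
proof (rule ccontr)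
  assume "\<not> L \<subseteq> K"
  then obtain a where "a \<in> L" "a \<notin> K" by blast
  then have "K \<subset> L" using lexseg_comparable assms by blast
  then have "card K < card L" by (rule psubset_card_mono[OF lexseg_finite[OF assms(2)]])
  then show False using assms(3) by simp
qed

section \<open>Stable sets\<close>

lemma mx_gt: "a \<in> mons m d \<Longrightarrow> mx a < i \<Longrightarrow> a i = 0"
proof -
  assume a: "a \<in> mons m d" and i: "mx a < i"
  have "\<exists>p. \<forall>i>p. a i = 0" using a by (auto simp: mons_def)
  then have "\<forall>i>mx a. a i = 0" unfolding mx_def by (rule LeastI_ex)
  with i show ?thesis by blast
qed

lemma mx_pos:
  assumes a: "a \<in> mons m d" and i: "i < mx a"
  shows "0 < a (mx a)"
proof (rule ccontr)
  assume "\<not> 0 < a (mx a)"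
  then have "\<forall>i>mx a - 1. a i = 0"
    using mx_gt[OF a] i by (metis Suc_pred gr_zeroI linorder_neqE_nat not_less_eq not_less_zero diff_Suc_1)
  then have "mx a \<le> mx a - 1" unfolding mx_def by (rule Least_le)
  with i show False by linarith
qed

lemma mx_le: "a \<in> mons m d \<Longrightarrow> mx a \<le> m"
  unfolding mx_def by (rule Least_le) (auto simp: mons_def)

lemma mx_le_iff:
  assumes "a \<in> mons m d"
  shows "mx a \<le> p \<longleftrightarrow> (\<forall>i>p. a i = 0)"
proof
  show "\<forall>i>p. a i = 0" if "mx a \<le> p" using mx_gt[OF assms] that by auto
  show "mx a \<le> p" if "\<forall>i>p. a i = 0" unfolding mx_def using that by (rule Least_le)
qed

lemma mons_move:
  assumes "a \<in> mons m d" "i < j" "0 < a j"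
  shows "a(i := a i + 1, j := a j - 1) \<in> mons m d"
proof -
  have jm: "j \<le> m" using mons_pos_le assms by blast
  let ?b = "a(i := a i + 1, j := a j - 1)"
  have "(\<Sum>k\<le>m. ?b k) = (\<Sum>k\<in>{..m}-{i,j}. ?b k) + (\<Sum>k\<in>{i,j}. ?b k)"
    by (rule sum.subset_diff) (use assms jm in auto)
  moreover have "(\<Sum>k\<le>m. a k) = (\<Sum>k\<in>{..m}-{i,j}. a k) + (\<Sum>k\<in>{i,j}. a k)"
    by (rule sum.subset_diff) (use assms jm in auto)
  moreover have "(\<Sum>k\<in>{..m}-{i,j}. ?b k) = (\<Sum>k\<in>{..m}-{i,j}. a k)"
    by (rule sum.cong) auto
  moreover have "(\<Sum>k\<in>{i,j}. ?b k) = (\<Sum>k\<in>{i,j}. a k)" using assms by auto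
  ultimately show ?thesis using assms jm by (auto simp: mons_def mdeg_def)
qed

lemma stable_move:
  assumes "strongly_stable S" "a \<in> S" "i < j" "0 < a j"
  shows "a(i := a i + 1, j := a j - 1) \<in> S"
  using assms(3,2,4)
proof (induction arbitrary: a rule: less_Suc_induct)
  case (1 i)
  then show ?case using assms(1) unfolding strongly_stable_def by blast
next
  case (2 i j k)
  let ?b = "a(j := a j + 1, k := a k - 1)"
  have "?b \<in> S" using 2 by blast
  moreover have "0 < ?b j" using 2 by simp
  ultimately have "?b(i := ?b i + 1, j := ?b j - 1) \<in> S" using 2(3) by blast
  moreover have "?b(i := ?b i + 1, j := ?b j - 1) = a(i := a i + 1, k := a k - 1)"
    using 2(1,2) by (auto simp: fun_eq_iff)
  ultimately show ?case by (simp only:)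
qed

text \<open>The multiples of \<open>\<nu>\<close> whose first \<open>d\<close> letters, variables being read in the order
  \<open>x\<^sub>0, x\<^sub>1, \<dots>\<close>, form \<open>\<nu>\<close>; these are the pieces of the Eliahou-Kervaire decomposition
  of a stable ideal.\<close>
definition cone :: "(nat \<Rightarrow> nat) \<Rightarrow> (nat \<Rightarrow> nat) set" where
  "cone \<nu> = {\<mu>. (\<forall>i<mx \<nu>. \<mu> i = \<nu> i) \<and> \<nu> (mx \<nu>) \<le> \<mu> (mx \<nu>)}"

text \<open>Of two monomials whose cones meet, the one with the smaller pair (last variable, its
  exponent) divides the other; equal degrees then force equality.\<close>

lemma cone_disjoint:
  assumes "\<nu> \<in> mons m d" "\<nu>' \<in> mons m d" "\<mu> \<in> cone \<nu>" "\<mu> \<in> cone \<nu>'"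
  shows "\<nu> = \<nu>'"
proof -
  have *: "\<nu> = \<nu>'" if "\<nu> \<in> mons m d" "\<nu>' \<in> mons m d" "\<mu> \<in> cone \<nu>" "\<mu> \<in> cone \<nu>'"
    "mx \<nu> < mx \<nu>' \<or> mx \<nu> = mx \<nu>' \<and> \<nu> (mx \<nu>) \<le> \<nu>' (mx \<nu>)" for \<nu> \<nu>'
  proof (rule mons_eqI[OF that(1,2)])
    fix i
    show "\<nu> i \<le> \<nu>' i"
      using that mx_gt[OF that(1), of i]
      by (cases i "mx \<nu>" rule: linorder_cases) (auto simp: cone_def)
  qed
  show ?thesis using *[of \<nu> \<nu>'] *[of \<nu>' \<nu>] assms
    by (metis linorder_neqE_nat nat_le_linear)
qed

lemma cone_mdvd:
  assumes "\<nu> \<in> mons m d" "\<mu> \<in> cone \<nu>"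
  shows "mdvd \<nu> \<mu>"
  unfolding mdvd_def
proof
  fix i show "\<nu> i \<le> \<mu> i"
    using assms(2) mx_gt[OF assms(1), of i]
    by (cases i "mx \<nu>" rule: linorder_cases) (auto simp: cone_def)
qed

text \<open>A potential that drops whenever a variable is traded for an earlier one. It selects the
  right divisor in \<open>stable_cone_cover\<close> and makes compression terminate.\<close>

definition wt :: "nat \<Rightarrow> (nat \<Rightarrow> nat) \<Rightarrow> nat" where
  "wt m a = (\<Sum>i\<le>m. i * a i)"

lemma wt_move:
  assumes "a \<in> mons m d" "i < j" "0 < a j"
  shows "wt m (a(i := a i + 1, j := a j - 1)) < wt m a"
proof -
  have jm: "j \<le> m" using mons_pos_le assms by blast
  let ?b = "a(i := a i + 1, j := a j - 1)"
  have "(\<Sum>k\<le>m. k * ?b k) = (\<Sum>k\<in>{..m}-{i,j}. k * ?b k) + (\<Sum>k\<in>{i,j}. k * ?b k)"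
    by (rule sum.subset_diff) (use assms jm in auto)
  moreover have "(\<Sum>k\<le>m. k * a k) = (\<Sum>k\<in>{..m}-{i,j}. k * a k) + (\<Sum>k\<in>{i,j}. k * a k)"
    by (rule sum.subset_diff) (use assms jm in auto)
  moreover have "(\<Sum>k\<in>{..m}-{i,j}. k * ?b k) = (\<Sum>k\<in>{..m}-{i,j}. k * a k)"
    by (rule sum.cong) auto
  moreover have "(\<Sum>k\<in>{i,j}. k * ?b k) < (\<Sum>k\<in>{i,j}. k * a k)"
  proof -
    obtain c where "a j = Suc c" using assms(3) gr0_conv_Suc by blast
    then show ?thesis using assms(2) by simp
  qed
  ultimately show ?thesis by (simp add: wt_def)
qed

text \<open>A divisor of least weight works: if \<mu> exceeded it at some x_i before its last
  variable, trading that last variable for x_i would give a lighter divisor in S.\<close>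

lemma stable_cone_cover:
  assumes "strongly_stable S" "S \<subseteq> mons m d" "\<nu> \<in> S" "mdvd \<nu> \<mu>"
  shows "\<exists>\<nu>'\<in>S. \<mu> \<in> cone \<nu>'"
proof -
  obtain a where a: "a \<in> S \<and> mdvd a \<mu>" and min: "\<And>b. b \<in> S \<and> mdvd b \<mu> \<Longrightarrow> wt m a \<le> wt m b"
    using ex_has_least_nat[of "\<lambda>a. a \<in> S \<and> mdvd a \<mu>" \<nu> "wt m"] assms by blast
  have am: "a \<in> mons m d" using a assms by blast
  have "\<mu> i = a i" if "i < mx a" for i
  proof (rule ccontr)
    assume "\<mu> i \<noteq> a i"
    then have lt: "a i < \<mu> i" using a by (auto simp: mdvd_def nat_less_le)
    let ?b = "a(i := a i + 1, mx a := a (mx a) - 1)"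
    have pos: "0 < a (mx a)" using mx_pos[OF am that] .
    have "?b \<in> S" using stable_move[OF assms(1), of a i "mx a"] that pos a by blast
    moreover have "mdvd ?b \<mu>" using a lt by (auto simp: mdvd_def intro: order_trans[OF diff_le_self])
    ultimately have "wt m a \<le> wt m ?b" using min by blast
    with wt_move[OF am that pos] show False by simp
  qed
  then have "\<mu> \<in> cone a" using a by (auto simp: cone_def mdvd_def)
  with a show ?thesis by blast
qed

lemma stable_card_multiples:
  assumes "strongly_stable S" "S \<subseteq> mons m d" "finite E"
  shows "card {\<mu>\<in>E. \<exists>\<nu>\<in>S. mdvd \<nu> \<mu>} = (\<Sum>\<nu>\<in>S. card (E \<inter> cone \<nu>))"
proof -
  have "{\<mu>\<in>E. \<exists>\<nu>\<in>S. mdvd \<nu> \<mu>} = (\<Union>\<nu>\<in>S. E \<inter> cone \<nu>)"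
  proof (intro equalityI subsetI)
    fix \<mu> assume "\<mu> \<in> {\<mu>\<in>E. \<exists>\<nu>\<in>S. mdvd \<nu> \<mu>}"
    then show "\<mu> \<in> (\<Union>\<nu>\<in>S. E \<inter> cone \<nu>)" using stable_cone_cover[OF assms(1,2)] by auto
  next
    fix \<mu> assume "\<mu> \<in> (\<Union>\<nu>\<in>S. E \<inter> cone \<nu>)"
    then obtain \<nu> where "\<nu> \<in> S" "\<mu> \<in> E" "\<mu> \<in> cone \<nu>" by auto
    then show "\<mu> \<in> {\<mu>\<in>E. \<exists>\<nu>\<in>S. mdvd \<nu> \<mu>}" using cone_mdvd[of \<nu> m d \<mu>] assms(2) by auto
  qed
  moreover have "card (\<Union>\<nu>\<in>S. E \<inter> cone \<nu>) = (\<Sum>\<nu>\<in>S. card (E \<inter> cone \<nu>))"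
  proof (rule card_UN_disjoint)
    show "\<forall>\<nu>\<in>S. \<forall>\<nu>'\<in>S. \<nu> \<noteq> \<nu>' \<longrightarrow> E \<inter> cone \<nu> \<inter> (E \<inter> cone \<nu>') = {}"
    proof (intro ballI impI, rule ccontr)
      fix \<nu> \<nu>' assume n: "\<nu> \<in> S" "\<nu>' \<in> S" "\<nu> \<noteq> \<nu>'"
        and "E \<inter> cone \<nu> \<inter> (E \<inter> cone \<nu>') \<noteq> {}"
      then obtain \<mu> where "\<mu> \<in> cone \<nu>" "\<mu> \<in> cone \<nu>'" by auto
      then show False using cone_disjoint[of \<nu> m d \<nu>' \<mu>] n assms(2) by auto
    qed
  qed (use assms finite_mons_subset in auto)
  ultimately show ?thesis by simp
qed

lemma stable_lexseg:
  assumes "lexseg m d L"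
  shows "strongly_stable L"
  unfolding strongly_stable_def
proof (intro ballI allI impI)
  fix a i assume a: "a \<in> L" and p: "0 < a (Suc i)"
  let ?b = "a(i := a i + 1, Suc i := a (Suc i) - 1)"
  have "?b \<in> mons m d" using mons_move[of a m d i "Suc i"] a p assms by (auto simp: lexseg_def)
  moreover have "lex_less a ?b" by (auto simp: lex_less_def intro!: exI[of _ i])
  ultimately show "?b \<in> L" using assms a unfolding lexseg_def by blast
qed

section \<open>Macaulay's theorem for stable sets\<close>

text \<open>Layer-cake formula: a sum of natural numbers is the sum over k of the sizes of the
  superlevel sets.\<close>

lemma sum_le_by_layers:
  fixes w :: "'b \<Rightarrow> nat"
  assumes "finite S" "finite L" "\<And>k. card {x\<in>L. k < w x} \<le> card {x\<in>S. k < w x}"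
  shows "sum w L \<le> sum w S"
proof -
  define B where "B = Suc (Max (insert 0 (w ` (S \<union> L))))"
  have layers: "sum w T = (\<Sum>k<B. card {x\<in>T. k < w x})" if "finite T" "T \<subseteq> S \<union> L" for T
  proof -
    have "w x \<le> B" if "x \<in> T" for x
      unfolding B_def using that \<open>T \<subseteq> S \<union> L\<close> assms by (intro le_SucI Max_ge) auto
    then have "{k\<in>{..<B}. k < w x} = {..<w x}" if "x \<in> T" for x using that by fastforce
    then have "sum w T = (\<Sum>x\<in>T. card {k\<in>{..<B}. k < w x})" by simp
    also have "\<dots> = (\<Sum>x\<in>T. \<Sum>k<B. of_bool (k < w x))"
      by (intro sum.cong refl) (simp add: Int_def conj_commute)
    also have "\<dots> = (\<Sum>k<B. \<Sum>x\<in>T. of_bool (k < w x))" by (rule sum.swap)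
    also have "\<dots> = (\<Sum>k<B. card {x\<in>T. k < w x})"
      by (intro sum.cong refl) (use \<open>finite T\<close> in \<open>simp add: Int_def conj_commute\<close>)
    finally show ?thesis .
  qed
  show ?thesis using assms by (simp add: layers sum_mono)
qed

section \<open>Division by the last variable, and shadows\<close>

definition mult_last :: "nat \<Rightarrow> (nat \<Rightarrow> nat) \<Rightarrow> nat \<Rightarrow> nat" where
  "mult_last P a = a(P := Suc (a P))"

text \<open>The degree-d part of the colon S : x_P. It is in bijection with the elements of S
  divisible by x_P and lowers the degree for the inductions.\<close>

definition colon_last :: "nat \<Rightarrow> nat \<Rightarrow> (nat \<Rightarrow> nat) set \<Rightarrow> (nat \<Rightarrow> nat) set" where
  "colon_last P d S = {a\<in>mons P d. mult_last P a \<in> S}"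

lemma mons_mult:
  assumes "a \<in> mons P d" "k \<le> P"
  shows "a(k := Suc (a k)) \<in> mons P (Suc d)"
proof -
  have "(\<Sum>i\<le>P. (a(k := Suc (a k))) i) = (\<Sum>i\<in>{..P}-{k}. (a(k := Suc (a k))) i) + Suc (a k)"
    using assms by (subst sum.remove[of _ k]) auto
  also have "(\<Sum>i\<in>{..P}-{k}. (a(k := Suc (a k))) i) = (\<Sum>i\<in>{..P}-{k}. a i)"
    by (rule sum.cong) auto
  also have "\<dots> + Suc (a k) = Suc (\<Sum>i\<le>P. a i)"
    using assms by (subst (2) sum.remove[of _ k]) auto
  finally show ?thesis using assms by (auto simp: mons_def mdeg_def)
qed

lemma mons_div:
  assumes "b \<in> mons P (Suc d)" "0 < b k"
  shows "b(k := b k - 1) \<in> mons P d" "k \<le> P"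
proof -
  show kP: "k \<le> P" using mons_pos_le assms by blast
  have "(\<Sum>i\<le>P. (b(k := b k - 1)) i) = (\<Sum>i\<in>{..P}-{k}. (b(k := b k - 1)) i) + (b k - 1)"
    using kP by (subst sum.remove[of _ k]) auto
  moreover have "(\<Sum>i\<in>{..P}-{k}. (b(k := b k - 1)) i) = (\<Sum>i\<in>{..P}-{k}. b i)"
    by (rule sum.cong) auto
  moreover have "(\<Sum>i\<le>P. b i) = (\<Sum>i\<in>{..P}-{k}. b i) + b k"
    using kP by (subst sum.remove[of _ k]) auto
  ultimately show "b(k := b k - 1) \<in> mons P d" using assms kP by (auto simp: mons_def mdeg_def)
qed

lemma mdvd_Suc:
  assumes "\<nu> \<in> mons P d" "\<mu> \<in> mons P (Suc d)" "mdvd \<nu> \<mu>"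
  obtains k where "k \<le> P" "\<mu> = \<nu>(k := Suc (\<nu> k))"
proof -
  have "\<exists>k. \<nu> k < \<mu> k"
  proof (rule ccontr)
    assume "\<not> ?thesis"
    then have "\<mu> = \<nu>" using assms by (auto simp: fun_eq_iff mdvd_def intro: antisym simp: not_less)
    then show False using assms by (auto simp: mons_def)
  qed
  then obtain k where k: "\<nu> k < \<mu> k" ..
  have m: "\<mu>(k := \<mu> k - 1) \<in> mons P d" "k \<le> P" using mons_div[OF assms(2), of k] k by auto
  have "\<nu> = \<mu>(k := \<mu> k - 1)"
    by (rule mons_eqI[OF assms(1) m(1)]) (use assms(3) k in \<open>auto simp: mdvd_def\<close>)
  then have "\<mu> = \<nu>(k := Suc (\<nu> k))" using k by auto
  with m that show ?thesis by blast
qed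

text \<open>The elements are \<nu> x_k with mx \<nu> <= k <= P; an earlier x_k would alter an
  exponent that the cone fixes.\<close>

lemma card_cone_Suc:
  assumes "\<nu> \<in> mons P d"
  shows "card (mons P (Suc d) \<inter> cone \<nu>) = Suc P - mx \<nu>"
proof -
  have "bij_betw (\<lambda>k. \<nu>(k := Suc (\<nu> k))) {mx \<nu>..P} (mons P (Suc d) \<inter> cone \<nu>)"
  proof (rule bij_betw_imageI)
    show "inj_on (\<lambda>k. \<nu>(k := Suc (\<nu> k))) {mx \<nu>..P}"
      by (rule inj_onI) (metis fun_upd_apply n_not_Suc_n)
    show "(\<lambda>k. \<nu>(k := Suc (\<nu> k))) ` {mx \<nu>..P} = mons P (Suc d) \<inter> cone \<nu>"
    proof (intro equalityI subsetI)
      fix \<mu> assume "\<mu> \<in> (\<lambda>k. \<nu>(k := Suc (\<nu> k))) ` {mx \<nu>..P}"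
      then show "\<mu> \<in> mons P (Suc d) \<inter> cone \<nu>"
        using mons_mult[OF assms] by (auto simp: cone_def)
    next
      fix \<mu> assume "\<mu> \<in> mons P (Suc d) \<inter> cone \<nu>"
      then have \<mu>: "\<mu> \<in> mons P (Suc d)" "\<mu> \<in> cone \<nu>" by auto
      obtain k where k: "k \<le> P" "\<mu> = \<nu>(k := Suc (\<nu> k))"
        by (rule mdvd_Suc[OF assms \<mu>(1) cone_mdvd[OF assms \<mu>(2)]])
      moreover have "mx \<nu> \<le> k" using \<mu>(2) k by (auto simp: cone_def not_less[symmetric])
      ultimately show "\<mu> \<in> (\<lambda>k. \<nu>(k := Suc (\<nu> k))) ` {mx \<nu>..P}" by auto
    qed
  qed
  from bij_betw_same_card[OF this] show ?thesis by simp
qed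

definition shadow :: "nat \<Rightarrow> nat \<Rightarrow> (nat \<Rightarrow> nat) set \<Rightarrow> (nat \<Rightarrow> nat) set" where
  "shadow P e S = {\<mu>\<in>mons P e. \<exists>\<nu>\<in>S. mdvd \<nu> \<mu>}"

lemma stable_colon_last:
  assumes "strongly_stable S"
  shows "strongly_stable (colon_last P d S)"
  unfolding strongly_stable_def
proof (intro ballI allI impI)
  fix a i assume "a \<in> colon_last P d S" and p: "0 < a (Suc i)"
  then have a: "a \<in> mons P d" "mult_last P a \<in> S" by (auto simp: colon_last_def)
  let ?b = "a(i := a i + 1, Suc i := a (Suc i) - 1)"
  have iP: "Suc i \<le> P" using mons_pos_le a(1) p by blast
  have "?b \<in> mons P d" using mons_move[of a P d i "Suc i"] a p by auto
  moreover have "(mult_last P a)(i := mult_last P a i + 1, Suc i := mult_last P a (Suc i) - 1) \<in> S"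
    by (rule stable_move[OF assms a(2)]) (use p in \<open>auto simp: mult_last_def\<close>)
  moreover have "(mult_last P a)(i := mult_last P a i + 1, Suc i := mult_last P a (Suc i) - 1)
      = mult_last P ?b"
    using iP p by (auto simp: mult_last_def fun_eq_iff)
  ultimately show "?b \<in> colon_last P d S" by (auto simp: colon_last_def)
qed

lemma lexseg_colon_last:
  assumes "lexseg P (Suc d) L"
  shows "lexseg P d (colon_last P d L)"
  unfolding lexseg_def
proof (intro conjI ballI impI)
  show "colon_last P d L \<subseteq> mons P d" by (auto simp: colon_last_def)
  fix a b assume a: "a \<in> colon_last P d L" and b: "b \<in> mons P d" and l: "lex_less a b"
  from l have "lex_less (mult_last P a) (mult_last P b)"
    by (auto simp: lex_less_def mult_last_def intro: exI)
  moreover have "mult_last P b \<in> mons P (Suc d)" using mons_mult[OF b] by (simp add: mult_last_def)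
  ultimately show "b \<in> colon_last P d L"
    using a b assms by (auto simp: colon_last_def lexseg_def)
qed

lemma card_last_ge:
  assumes "S \<subseteq> mons P (Suc d)"
  shows "card {a\<in>S. Suc c \<le> a P} = card {a\<in>colon_last P d S. c \<le> a P}"
proof -
  have "bij_betw (mult_last P) {a\<in>colon_last P d S. c \<le> a P} {a\<in>S. Suc c \<le> a P}"
  proof (rule bij_betw_imageI)
    show "inj_on (mult_last P) {a\<in>colon_last P d S. c \<le> a P}"
      by (rule inj_onI) (metis fun_upd_triv fun_upd_upd mult_last_def fun_upd_same nat.inject)
    show "mult_last P ` {a\<in>colon_last P d S. c \<le> a P} = {a\<in>S. Suc c \<le> a P}"
    proof (intro equalityI subsetI)
      fix b assume "b \<in> {a\<in>S. Suc c \<le> a P}"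
      then have b: "b \<in> S" "Suc c \<le> b P" by auto
      let ?a = "b(P := b P - 1)"
      have e: "b = mult_last P ?a" using b by (auto simp: mult_last_def)
      have "?a \<in> mons P d" using mons_div[of b P d P] b assms by auto
      then have "?a \<in> {a\<in>colon_last P d S. c \<le> a P}"
        using b e by (auto simp: colon_last_def mult_last_def)
      then show "b \<in> mult_last P ` {a\<in>colon_last P d S. c \<le> a P}" using e by blast
    qed (auto simp: colon_last_def mult_last_def)
  qed
  then show ?thesis by (simp add: bij_betw_same_card)
qed

text \<open>If \<nu> x_P lies in S, the move from x_P to x_k turns it into \<nu> x_k.\<close>

lemma shadow_colon_last:
  assumes "strongly_stable S"
  shows "shadow P (Suc d) (colon_last P d S) \<subseteq> S"
proof
  fix \<mu> assume "\<mu> \<in> shadow P (Suc d) (colon_last P d S)"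
  then obtain \<nu> where \<nu>: "\<mu> \<in> mons P (Suc d)" "\<nu> \<in> mons P d" "mult_last P \<nu> \<in> S" "mdvd \<nu> \<mu>"
    by (auto simp: shadow_def colon_last_def)
  obtain k where k: "k \<le> P" "\<mu> = \<nu>(k := Suc (\<nu> k))" using mdvd_Suc \<nu> by metis
  show "\<mu> \<in> S"
  proof (cases "k = P")
    case True then show ?thesis using k \<nu> by (simp add: mult_last_def)
  next
    case False
    then have "(mult_last P \<nu>)(k := mult_last P \<nu> k + 1, P := mult_last P \<nu> P - 1) \<in> S"
      using stable_move[OF assms \<nu>(3), of k P] k by (auto simp: mult_last_def)
    also have "(mult_last P \<nu>)(k := mult_last P \<nu> k + 1, P := mult_last P \<nu> P - 1) = \<mu>"
      using False k by (auto simp: mult_last_def fun_eq_iff)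
    finally show ?thesis .
  qed
qed

text \<open>Removing the last variable gives the lexicographically largest divisor of degree d, so
  membership in the shadow of K can be tested on that divisor alone, and the removal is weakly
  monotone.\<close>

lemma lexseg_shadow:
  assumes "lexseg P d K"
  shows "lexseg P (Suc d) (shadow P (Suc d) K)"
  unfolding lexseg_def
proof (intro conjI ballI impI)
  show "shadow P (Suc d) K \<subseteq> mons P (Suc d)" by (auto simp: shadow_def)
  fix a b assume a: "a \<in> shadow P (Suc d) K" and b: "b \<in> mons P (Suc d)" and l: "lex_less a b"
  have am: "a \<in> mons P (Suc d)" using a by (auto simp: shadow_def)
  have pos: "0 < c (mx c)" if "c \<in> mons P (Suc d)" for c
  proof (cases "mx c = 0")
    case True
    then have "mdeg P c = c 0" using mx_gt[OF that] unfolding mdeg_def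
      by (subst sum.mono_neutral_right[of "{..P}" "{0}"]) auto
    then show ?thesis using that True by (simp add: mons_def)
  qed (use mx_pos[OF that, of 0] in auto)
  define a' where "a' = a(mx a := a (mx a) - 1)"
  define b' where "b' = b(mx b := b (mx b) - 1)"
  have a'm: "a' \<in> mons P d" and b'm: "b' \<in> mons P d"
    using mons_div pos am b by (auto simp: a'_def b'_def)
  obtain \<nu> where \<nu>: "\<nu> \<in> K" "mdvd \<nu> a" using a by (auto simp: shadow_def)
  have \<nu>m: "\<nu> \<in> mons P d" using \<nu> assms by (auto simp: lexseg_def)
  obtain k where k: "k \<le> P" "a = \<nu>(k := Suc (\<nu> k))" using mdvd_Suc[OF \<nu>m am \<nu>(2)] by metis
  have kmx: "k \<le> mx a" using mx_gt[OF am, of k] k by (auto simp: not_less[symmetric])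
  have "a' \<in> K"
  proof (cases "k = mx a")
    case True then show ?thesis using k \<nu> by (simp add: a'_def)
  next
    case False
    then have "lex_less \<nu> a'" using k kmx by (auto simp: lex_less_def a'_def intro!: exI[of _ k])
    then show ?thesis using assms \<nu> a'm by (auto simp: lexseg_def)
  qed
  moreover have "a' = b' \<or> lex_less a' b'"
  proof -
    obtain i where i: "\<forall>j<i. b j = a j" "a i < b i" using l by (auto simp: lex_less_def)
    have ib: "i \<le> mx b" using i(2) mx_gt[OF b, of i] by (auto simp: not_less[symmetric])
    have ia: "i < mx a"
    proof (rule ccontr)
      assume "\<not> i < mx a"
      then have "a j \<le> b j" for j
        using i mx_gt[OF am, of j] by (cases i j rule: linorder_cases) auto
      then have "a = b" by (intro mons_eqI[OF am b])
      then show False using i by simp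
    qed
    show ?thesis
    proof (cases "i < mx b \<or> Suc (a i) < b i")
      case True
      then show ?thesis using i ia ib
        by (auto simp: lex_less_def a'_def b'_def intro!: disjI2 exI[of _ i])
    next
      case False
      then have ib: "i = mx b" "b i = Suc (a i)" using ib i by auto
      \<comment> \<open>Here the removal of x_i from b cancels its only advantage over a, so b'
        divides a' and, by degree, equals it.\<close>
      have "b' j \<le> a' j" for j
        using ib ia i(1) mx_gt[OF b, of j]
        by (cases i j rule: linorder_cases) (auto simp: a'_def b'_def)
      then have "b' = a'" by (intro mons_eqI[OF b'm a'm])
      then show ?thesis by simp
    qed
  qed
  ultimately have "b' \<in> K" using assms b'm by (auto simp: lexseg_def)
  moreover have "mdvd b' b" by (auto simp: mdvd_def b'_def)
  ultimately show "b \<in> shadow P (Suc d) K" using b by (auto simp: shadow_def)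
qed

text \<open>Bayer's comparison in degree d, for all numbers of variables at once. It is a named
  predicate because the step to degree d+1 runs through lemmas that assume it in degree d.\<close>

definition restricted_count :: "nat \<Rightarrow> bool" where
  "restricted_count d \<longleftrightarrow> (\<forall>P S L p. S \<subseteq> mons P d \<longrightarrow> strongly_stable S \<longrightarrow> lexseg P d L \<longrightarrow> card L \<le> card S \<longrightarrow>
      card {a\<in>L. mx a \<le> p} \<le> card {a\<in>S. mx a \<le> p})"

text \<open>By the cone decomposition the shadow has size the sum of P + 1 - mx \<nu>, and the
  superlevel sets of this weight are those counted by \<open>restricted_count\<close>.\<close>

lemma shadow_card_le:
  assumes "restricted_count d" "S \<subseteq> mons P d" "strongly_stable S" "lexseg P d K" "card K \<le> card S"
  shows "card (shadow P (Suc d) K) \<le> card (shadow P (Suc d) S)"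
proof -
  have K: "K \<subseteq> mons P d" using assms by (simp add: lexseg_def)
  have sh: "card (shadow P (Suc d) T) = (\<Sum>\<nu>\<in>T. Suc P - mx \<nu>)" if "T \<subseteq> mons P d" "strongly_stable T" for T
    unfolding shadow_def stable_card_multiples[OF that(2,1) finite_mons]
    by (intro sum.cong refl card_cone_Suc) (use that in blast)
  have "(\<Sum>\<nu>\<in>K. Suc P - mx \<nu>) \<le> (\<Sum>\<nu>\<in>S. Suc P - mx \<nu>)"
  proof (rule sum_le_by_layers)
    fix k
    show "card {x \<in> K. k < Suc P - mx x} \<le> card {x \<in> S. k < Suc P - mx x}"
    proof (cases "k \<le> P")
      case True
      have "{x \<in> T. k < Suc P - mx x} = {x \<in> T. mx x \<le> P - k}" for T using True by auto
      then show ?thesis using assms unfolding restricted_count_def by auto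
    next
      case False
      then have "{x \<in> K. k < Suc P - mx x} = {}" by auto
      then show ?thesis by (simp only: card.empty)
    qed
  qed (use assms K finite_mons_subset in auto)
  then show ?thesis using sh K assms stable_lexseg by simp
qed

text \<open>Otherwise the segment K of the same size as the colon of S is not contained in the colon
  of L. Its shadow then properly contains L, yet is no larger than the shadow of the colon of S,
  which lies in S.\<close>

lemma colon_last_card_le:
  assumes "restricted_count d" "S \<subseteq> mons P (Suc d)" "strongly_stable S" "lexseg P (Suc d) L" "card S \<le> card L"
  shows "card (colon_last P d S) \<le> card (colon_last P d L)"
proof (rule ccontr)
  assume "\<not> ?thesis"
  then have gt: "card (colon_last P d L) < card (colon_last P d S)" by simp
  have sub: "colon_last P d S \<subseteq> mons P d" by (auto simp: colon_last_def)
  obtain K where K: "lexseg P d K" "card K = card (colon_last P d S)"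
    using lexseg_exists[OF card_mono[OF finite_mons sub]] by metis
  have "\<not> K \<subseteq> colon_last P d L"
  proof
    assume "K \<subseteq> colon_last P d L"
    then have "card K \<le> card (colon_last P d L)"
      by (rule card_mono[OF lexseg_finite[OF lexseg_colon_last[OF assms(4)]]])
    then show False using gt K by simp
  qed
  then obtain \<nu> where \<nu>: "\<nu> \<in> K" "\<nu> \<notin> colon_last P d L" by blast
  have \<nu>m: "\<nu> \<in> mons P d" using \<nu> K by (auto simp: lexseg_def)
  have "mult_last P \<nu> \<in> shadow P (Suc d) K"
    using mons_mult[OF \<nu>m, of P] \<nu>(1)
    by (auto simp: shadow_def mult_last_def mdvd_def intro!: bexI[of _ \<nu>])
  moreover have "mult_last P \<nu> \<notin> L" using \<nu> \<nu>m by (auto simp: colon_last_def)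
  ultimately have "L \<subset> shadow P (Suc d) K"
    using lexseg_comparable[OF lexseg_shadow[OF K(1)] assms(4)] by blast
  then have "card L < card (shadow P (Suc d) K)"
    by (rule psubset_card_mono[OF lexseg_finite[OF lexseg_shadow[OF K(1)]]])
  also have "\<dots> \<le> card (shadow P (Suc d) (colon_last P d S))"
    using shadow_card_le[OF assms(1) sub stable_colon_last[OF assms(3)] K(1)] K(2) by simp
  also have "\<dots> \<le> card S"
    by (rule card_mono[OF finite_mons_subset[OF assms(2)] shadow_colon_last[OF assms(3)]])
  finally show False using assms(5) by simp
qed

text \<open>Complementation: within sets of equal size, fewer high exponents means more low ones. L'
  is the segment of exactly the size of S, and L lies inside it.\<close>

lemma last_count_le_imp:
  assumes "S \<subseteq> mons P d" "lexseg P d L" "card L \<le> card S"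
    and step: "\<And>L'. lexseg P d L' \<Longrightarrow> card S \<le> card L' \<Longrightarrow> card {a\<in>S. Suc c \<le> a P} \<le> card {a\<in>L'. Suc c \<le> a P}"
  shows "card {a\<in>L. a P \<le> c} \<le> card {a\<in>S. a P \<le> c}"
proof -
  obtain L' where L': "lexseg P d L'" "card L' = card S"
    using lexseg_exists[OF card_mono[OF finite_mons assms(1)]] by metis
  have LL: "L \<subseteq> L'" using lexseg_card_le[OF L'(1) assms(2)] assms(3) L' by simp
  have split: "card T = card {a\<in>T. a P \<le> c} + card {a\<in>T. Suc c \<le> a P}" if "finite T" for T :: "(nat \<Rightarrow> nat) set"
  proof -
    have "card ({a\<in>T. a P \<le> c} \<union> {a\<in>T. Suc c \<le> a P}) = card {a\<in>T. a P \<le> c} + card {a\<in>T. Suc c \<le> a P}"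
      using that by (intro card_Un_disjoint) auto
    moreover have "{a\<in>T. a P \<le> c} \<union> {a\<in>T. Suc c \<le> a P} = T" by auto
    ultimately show ?thesis by simp
  qed
  have "card {a\<in>L. a P \<le> c} \<le> card {a\<in>L'. a P \<le> c}"
    by (rule card_mono) (use LL lexseg_finite[OF L'(1)] in auto)
  also have "\<dots> \<le> card {a\<in>S. a P \<le> c}"
    using split[OF lexseg_finite[OF L'(1)]] split[OF finite_mons_subset[OF assms(1)]] step[OF L'(1)] L'(2)
    by simp
  finally show ?thesis .
qed

lemma mons_Suc_zero: "{a\<in>mons (Suc P) d. a (Suc P) = 0} = mons P d"
proof -
  have "(\<forall>i>P. a i = 0) \<longleftrightarrow> (\<forall>i>Suc P. a i = 0) \<and> a (Suc P) = 0" for a :: "nat \<Rightarrow> nat"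
    by (metis Suc_lessD Suc_lessI lessI)
  then show ?thesis by (auto simp: mons_def mdeg_def)
qed

lemma restrict_Suc:
  assumes "S \<subseteq> mons (Suc P) d" "strongly_stable S" "lexseg (Suc P) d L"
  shows "{a\<in>S. a (Suc P) = 0} \<subseteq> mons P d" "strongly_stable {a\<in>S. a (Suc P) = 0}"
    "lexseg P d {a\<in>L. a (Suc P) = 0}"
proof -
  show "{a\<in>S. a (Suc P) = 0} \<subseteq> mons P d" using assms(1) mons_Suc_zero by blast
  show "strongly_stable {a\<in>S. a (Suc P) = 0}"
    unfolding strongly_stable_def
  proof (intro ballI allI impI)
    fix a i assume a: "a \<in> {a \<in> S. a (Suc P) = 0}" and p: "0 < a (Suc i)"
    have "i \<noteq> Suc P"
      using a assms(1) p by (auto simp: mons_def)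
    then show "a(i := a i + 1, Suc i := a (Suc i) - 1) \<in> {a \<in> S. a (Suc P) = 0}"
      using a p assms(2) by (auto simp: strongly_stable_def)
  qed
  show "lexseg P d {a\<in>L. a (Suc P) = 0}"
    using assms(3) mons_Suc_zero[of P d] unfolding lexseg_def by blast
qed

text \<open>Induction on the degree and, inside it, on the number of variables. If p is not the last
  index, the elements free of the last variable are compared through the colon in lower degree, and
  they satisfy the hypotheses with one variable less.\<close>

lemma restricted_count: "restricted_count d"
proof (induction d)
  case 0
  have z: "mons P 0 \<subseteq> {\<lambda>_. 0}" for P
  proof
    fix a assume "a \<in> mons P 0"
    then have "a i = 0" for i using mons_le[of a P 0 i] by simp
    then show "a \<in> {\<lambda>_. 0}" by auto
  qed
  have "L \<subseteq> S" if "S \<subseteq> mons P 0" "lexseg P 0 L" "card L \<le> card S" for P S L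
  proof -
    have "S = {} \<or> S = {\<lambda>_. 0}" "L = {} \<or> L = {\<lambda>_. 0}"
      using that(1,2) z[of P] unfolding lexseg_def by (meson subset_singletonD subset_trans)+
    then show ?thesis using that(3) by auto
  qed
  then have "card {a\<in>L. mx a \<le> p} \<le> card {a\<in>S. mx a \<le> p}"
    if "S \<subseteq> mons P 0" "lexseg P 0 L" "card L \<le> card S" for P S L p
    using that finite_mons_subset[OF that(1)] by (intro card_mono) auto
  then show ?case unfolding restricted_count_def by (intro allI impI)
next
  case (Suc d)
  have "card {a\<in>L. mx a \<le> p} \<le> card {a\<in>S. mx a \<le> p}"
    if "S \<subseteq> mons P (Suc d)" "strongly_stable S" "lexseg P (Suc d) L" "card L \<le> card S" for P S L p
    using that
  proof (induction P arbitrary: S L)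
    case 0
    then have "{a\<in>L. mx a \<le> p} = L" "{a\<in>S. mx a \<le> p} = S"
      using mx_le[of _ 0 "Suc d"] unfolding lexseg_def by fastforce+
    then show ?case using 0 by simp
  next
    case (Suc P)
    show ?case
    proof (cases "Suc P \<le> p")
      case True
      then have "{a\<in>L. mx a \<le> p} = L" "{a\<in>S. mx a \<le> p} = S"
        using Suc.prems mx_le[of _ "Suc P" "Suc d"] unfolding lexseg_def by fastforce+
      then show ?thesis using Suc.prems by simp
    next
      case False
      have LS: "L \<subseteq> mons (Suc P) (Suc d)" using Suc.prems by (simp add: lexseg_def)
      have "card {a\<in>L. a (Suc P) \<le> 0} \<le> card {a\<in>S. a (Suc P) \<le> 0}"
      proof (rule last_count_le_imp[OF Suc.prems(1,3,4)])
        fix L' assume L': "lexseg (Suc P) (Suc d) L'" "card S \<le> card L'"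
        then have "L' \<subseteq> mons (Suc P) (Suc d)" by (simp add: lexseg_def)
        then show "card {a \<in> S. Suc 0 \<le> a (Suc P)} \<le> card {a \<in> L'. Suc 0 \<le> a (Suc P)}"
          using colon_last_card_le[OF \<open>restricted_count d\<close> Suc.prems(1,2) L']
          by (simp add: card_last_ge[OF Suc.prems(1)] card_last_ge del: One_nat_def)
      qed
      then have "card {a\<in>L. a (Suc P) = 0} \<le> card {a\<in>S. a (Suc P) = 0}" by simp
      then have "card {a\<in>{a\<in>L. a (Suc P) = 0}. mx a \<le> p} \<le> card {a\<in>{a\<in>S. a (Suc P) = 0}. mx a \<le> p}"
        by (rule Suc.IH[OF restrict_Suc[OF Suc.prems(1,2,3)]])
      moreover have "{a\<in>{a\<in>T. a (Suc P) = 0}. mx a \<le> p} = {a\<in>T. mx a \<le> p}"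
        if "T \<subseteq> mons (Suc P) (Suc d)" for T
        using that False mx_gt[of _ "Suc P" "Suc d" "Suc P"] by force
      ultimately show ?thesis using LS Suc.prems by simp
    qed
  qed
  then show ?case unfolding restricted_count_def by (intro allI impI)
qed

text \<open>Each colon by x_P lowers both c and d by one, and \<open>colon_last_card_le\<close>
  restores the hypothesis on sizes.\<close>

lemma last_count_ge:
  assumes "S \<subseteq> mons P d" "strongly_stable S" "lexseg P d L" "card S \<le> card L"
  shows "card {a\<in>S. c \<le> a P} \<le> card {a\<in>L. c \<le> a P}"
  using assms
proof (induction c arbitrary: S L d)
  case 0 then show ?case by simp
next
  case (Suc c)
  show ?case
  proof (cases d)
    case 0
    then have "{a\<in>S. Suc c \<le> a P} = {}" using mons_le Suc.prems(1) by force
    then show ?thesis by (simp only: card.empty)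
  next
    case (Suc d')
    have "L \<subseteq> mons P (Suc d')" using Suc.prems Suc by (simp add: lexseg_def)
    moreover have "card {a\<in>colon_last P d' S. c \<le> a P} \<le> card {a\<in>colon_last P d' L. c \<le> a P}"
      using Suc.prems Suc
      by (intro Suc.IH[of _ d'] stable_colon_last lexseg_colon_last colon_last_card_le restricted_count)
        (auto simp: colon_last_def)
    ultimately show ?thesis using Suc.prems(1) Suc by (simp add: card_last_ge)
  qed
qed

text \<open>The condition says that the pair (mx a, exponent there) is at most (p, c)
  lexicographically. For p = P this is \<open>last_count_ge\<close> in complementary form; otherwise
  the slice without x_P has one variable less.\<close>

lemma stable_count_ge_lexseg:
  assumes "S \<subseteq> mons P d" "strongly_stable S" "lexseg P d L" "card L \<le> card S" "p \<le> P"
  shows "card {a\<in>L. (\<forall>i>p. a i = 0) \<and> a p \<le> c} \<le> card {a\<in>S. (\<forall>i>p. a i = 0) \<and> a p \<le> c}"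
  using assms
proof (induction P arbitrary: S L)
  case 0
  have "{a\<in>T. (\<forall>i>p. a i = 0) \<and> a p \<le> c} = {a\<in>T. a 0 \<le> c}" if "T \<subseteq> mons 0 d" for T
    using that 0 by (auto simp: mons_def)
  moreover have "card {a\<in>L. a 0 \<le> c} \<le> card {a\<in>S. a 0 \<le> c}"
    by (rule last_count_le_imp[OF 0(1,3,4)]) (use 0 last_count_ge in blast)
  ultimately show ?case using 0 by (simp add: lexseg_def)
next
  case (Suc P)
  have LS: "L \<subseteq> mons (Suc P) d" using Suc.prems by (simp add: lexseg_def)
  have le: "card {a\<in>L. a (Suc P) \<le> c} \<le> card {a\<in>S. a (Suc P) \<le> c}" for c
    by (rule last_count_le_imp[OF Suc.prems(1,3,4)]) (use Suc last_count_ge in blast)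
  show ?case
  proof (cases "p = Suc P")
    case True
    have "{a\<in>T. (\<forall>i>p. a i = 0) \<and> a p \<le> c} = {a\<in>T. a (Suc P) \<le> c}" if "T \<subseteq> mons (Suc P) d" for T
      using that True by (auto simp: mons_def)
    then show ?thesis using le LS Suc.prems by simp
  next
    case False
    have "card {a\<in>L. a (Suc P) = 0} \<le> card {a\<in>S. a (Suc P) = 0}" using le[of 0] by simp
    then have "card {a\<in>{a\<in>L. a (Suc P) = 0}. (\<forall>i>p. a i = 0) \<and> a p \<le> c}
        \<le> card {a\<in>{a\<in>S. a (Suc P) = 0}. (\<forall>i>p. a i = 0) \<and> a p \<le> c}"
      by (rule Suc.IH[OF restrict_Suc[OF Suc.prems(1,2,3)]]) (use False Suc.prems in simp)
    moreover have "{a\<in>{a\<in>T. a (Suc P) = 0}. (\<forall>i>p. a i = 0) \<and> a p \<le> c} = {a\<in>T. (\<forall>i>p. a i = 0) \<and> a p \<le> c}"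
      for T :: "(nat \<Rightarrow> nat) set"
    proof -
      have "p < Suc P" using False Suc.prems(5) by simp
      then show ?thesis by blast
    qed
    ultimately show ?thesis by (simp only:)
  qed
qed

section \<open>Compression\<close>

text \<open>The sumset bound |X + [0,D]| >= |X| + D: besides X itself there are D points after its
  maximum.\<close>

lemma card_sumset_interval:
  fixes X :: "nat set"
  assumes "finite X" "X \<noteq> {}"
  shows "card X + D \<le> card {s. \<exists>x\<in>X. x \<le> s \<and> s \<le> x + D}"
proof -
  let ?Y = "{s. \<exists>x\<in>X. x \<le> s \<and> s \<le> x + D}"
  have "?Y \<subseteq> {..Max X + D}" using assms by (auto intro: order_trans[OF _ add_right_mono[OF Max_ge]])
  then have fin: "finite ?Y" by (rule finite_subset) simp
  have "X \<inter> {Max X<..Max X + D} = {}" using Max_ge[OF assms(1)] by fastforce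
  then have "card (X \<union> {Max X<..Max X + D}) = card X + D"
    using assms by (subst card_Un_disjoint) auto
  moreover have "X \<subseteq> ?Y" by auto
  moreover have "{Max X<..Max X + D} \<subseteq> ?Y"
    using Max_in[OF assms] by (auto intro!: bexI[of _ "Max X"])
  ultimately show ?thesis using card_mono[OF fin, of "X \<union> {Max X<..Max X + D}"] by simp
qed

text \<open>Read s as the exponent of x_i on a line of total exponent N, and X as such exponents on
  a line of total n. A monomial with exponents (s, N-s) is a multiple of (x, n-x) iff x <= s <= x +
  (N-n). Compression replaces X by the top |X| elements of {..n}, whose multiples are all s >=
  n+1-|X|. The set A is the reduced range when a later variable occurs.\<close>

lemma card_interval_chain:
  fixes X :: "nat set"
  assumes X: "X \<subseteq> {..n}" "X \<noteq> {}" and n: "n < q" "n \<le> N"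
  defines "A \<equiv> {s. s \<le> N \<and> s < q \<and> N - s < q}"
  shows "card {s\<in>A. n + 1 - card X \<le> s} \<le> card {s\<in>A. \<exists>x\<in>X. x \<le> s \<and> s \<le> x + (N - n)}"
proof (cases "\<forall>s\<in>A. \<exists>x\<in>X. x \<le> s \<and> s \<le> x + (N - n)")
  case True
  have "finite A" unfolding A_def by simp
  then show ?thesis using True by (intro card_mono) auto
next
  case False
  \<comment> \<open>An uncovered point a of A separates the intervals into those below and those
    above it. Each group can leave A at one end only, so it loses at most N - \<beta> points instead
    of twice as many.\<close>
  then obtain a where a: "a \<in> A" and na: "\<And>x. x \<in> X \<Longrightarrow> x \<le> a \<Longrightarrow> x + (N - n) < a" by force
  define \<beta> where "\<beta> = min N (q - 1)"
  define D where "D = N - n"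
  define Y where "Y = (\<lambda>X. {s. \<exists>x\<in>X. x \<le> s \<and> s \<le> x + D})"
  have finX: "finite X" using X(1) finite_subset by blast
  have finA: "finite A" unfolding A_def by simp
  have A: "A = {N - \<beta>..\<beta>}" unfolding A_def \<beta>_def using n by auto
  have n\<beta>: "n \<le> \<beta>" "\<beta> \<le> N" using n by (auto simp: \<beta>_def)
  define X1 where "X1 = {x\<in>X. x < a}"
  define X2 where "X2 = {x\<in>X. a < x}"
  have XU: "X = X1 \<union> X2" using na unfolding X1_def X2_def D_def by force
  have cX: "card X = card X1 + card X2"
    unfolding XU by (rule card_Un_disjoint) (use finX in \<open>auto simp: X1_def X2_def\<close>)
  have Y1: "Y X1 \<subseteq> {..<a}" using na by (force simp: Y_def X1_def D_def)
  have Y2: "Y X2 \<subseteq> {a<..N}" using X(1) n by (force simp: Y_def X2_def D_def)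
  have l1: "card X1 + \<beta> - n \<le> card (A \<inter> Y X1)" if "X1 \<noteq> {}"
  proof -
    have "card X1 + D \<le> card (Y X1)"
      unfolding Y_def using that finX by (intro card_sumset_interval) (auto simp: X1_def)
    moreover have "Y X1 \<subseteq> (A \<inter> Y X1) \<union> {..<N - \<beta>}" using Y1 a A by force
    then have "card (Y X1) \<le> card ((A \<inter> Y X1) \<union> {..<N - \<beta>})"
      using finA by (intro card_mono) auto
    moreover have "card ((A \<inter> Y X1) \<union> {..<N - \<beta>}) \<le> card (A \<inter> Y X1) + card {..<N - \<beta>}"
      by (rule card_Un_le)
    ultimately show ?thesis using n\<beta> by (simp add: D_def)
  qed
  have l2: "card X2 + \<beta> - n \<le> card (A \<inter> Y X2)" if "X2 \<noteq> {}"
  proof -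
    have "card X2 + D \<le> card (Y X2)"
      unfolding Y_def using that finX by (intro card_sumset_interval) (auto simp: X2_def)
    moreover have "Y X2 \<subseteq> (A \<inter> Y X2) \<union> {\<beta><..N}" using Y2 a A by force
    then have "card (Y X2) \<le> card ((A \<inter> Y X2) \<union> {\<beta><..N})"
      using finA by (intro card_mono) auto
    moreover have "card ((A \<inter> Y X2) \<union> {\<beta><..N}) \<le> card (A \<inter> Y X2) + card {\<beta><..N}"
      by (rule card_Un_le)
    ultimately show ?thesis using n\<beta> by (simp add: D_def)
  qed
  have "card (A \<inter> Y X1) + card (A \<inter> Y X2) = card ((A \<inter> Y X1) \<union> (A \<inter> Y X2))"
    using Y1 Y2 finA by (intro card_Un_disjoint[symmetric]) force+
  also have "\<dots> \<le> card {s\<in>A. \<exists>x\<in>X. x \<le> s \<and> s \<le> x + (N - n)}"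
    using finA by (intro card_mono) (auto simp: Y_def D_def X1_def X2_def)
  finally have U: "card (A \<inter> Y X1) + card (A \<inter> Y X2) \<le> card {s\<in>A. \<exists>x\<in>X. x \<le> s \<and> s \<le> x + (N - n)}" .
  \<comment> \<open>Each nonempty group contributes a surplus \<beta> - n >= 0, and one such surplus
    is enough.\<close>
  have "card X + \<beta> - n \<le> card (A \<inter> Y X1) + card (A \<inter> Y X2)"
  proof (cases "X1 = {}"; cases "X2 = {}")
    assume "X1 = {}" "X2 = {}" then show ?thesis using XU X by simp
  next
    assume "X1 = {}" "X2 \<noteq> {}" then show ?thesis using cX l2 by simp
  next
    assume "X1 \<noteq> {}" "X2 = {}" then show ?thesis using cX l1 by simp
  next
    assume "X1 \<noteq> {}" "X2 \<noteq> {}" then show ?thesis using cX l1 l2 n\<beta> by simp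
  qed
  moreover have "card {s\<in>A. n + 1 - card X \<le> s} \<le> card {n + 1 - card X..\<beta>}"
    by (rule card_mono) (auto simp: A)
  moreover have "card X \<le> n + 1" using card_mono[OF _ X(1)] by simp
  ultimately show ?thesis using U n\<beta> by simp
qed

text \<open>The range when no variable after x_{i+1} occurs: the exponent N - s is then uncapped,
  and s = N is allowed even beyond q because x_i has become the last variable.\<close>

lemma card_interval_top_chain:
  fixes X :: "nat set"
  assumes X: "X \<subseteq> {..n}" "X \<noteq> {}" and n: "n < q" "n \<le> N"
  defines "A \<equiv> {s. s \<le> N \<and> (s < q \<or> s = N)}"
  shows "card {s\<in>A. n + 1 - card X \<le> s} \<le> card {s\<in>A. \<exists>x\<in>X. x \<le> s \<and> s \<le> x + (N - n)}"
proof (cases "N < q")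
  case True
  then have "A = {s. s \<le> N \<and> s < q \<and> N - s < q}" unfolding A_def by auto
  then show ?thesis using card_interval_chain[OF X n] by simp
next
  case False
  have finX: "finite X" using X(1) finite_subset by blast
  have finA: "finite A" unfolding A_def by simp
  have cXn: "card X \<le> n + 1" using card_mono[OF _ X(1)] by simp
  let ?R = "{s\<in>A. \<exists>x\<in>X. x \<le> s \<and> s \<le> x + (N - n)}"
  have finR: "finite ?R" using finA by simp
  have "card {s\<in>A. n + 1 - card X \<le> s} \<le> card (insert N {n + 1 - card X..<q})"
    by (rule card_mono) (auto simp: A_def)
  also have "\<dots> \<le> Suc (q + card X - (n + 1))" using cXn n by (auto simp: card_insert_if)
  also have "\<dots> \<le> card ?R"
  \<comment> \<open>The far point N is covered only by the interval starting at n. If n is missing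
    from X, the point gained from max X < n makes up for it.\<close>
  proof (cases "n \<in> X")
    case True
    have "X \<subseteq> ?R" using X n by (fastforce simp: A_def)
    moreover have "{n<..<q} \<union> {N} \<subseteq> ?R"
      using n True False by (auto simp: A_def intro!: bexI[of _ n])
    ultimately have "X \<union> {n<..<q} \<union> {N} \<subseteq> ?R" by blast
    then have "card (X \<union> {n<..<q} \<union> {N}) \<le> card ?R" by (rule card_mono[OF finR])
    moreover have "card (X \<union> {n<..<q} \<union> {N}) = card (X \<union> {n<..<q}) + card {N}"
      using X(1) finX n False by (intro card_Un_disjoint) auto
    moreover have "card (X \<union> {n<..<q}) = card X + card {n<..<q}"
      using X(1) finX by (intro card_Un_disjoint) auto
    ultimately show ?thesis using n by simp
  next
    case nX: False
    define M where "M = Max X"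
    have MX: "M \<in> X" and Mx: "\<And>x. x \<in> X \<Longrightarrow> x \<le> M" using X finX by (auto simp: M_def)
    have Mn: "M < n" using MX nX X(1) by (metis atMost_iff nat_less_le subsetD)
    let ?h = "min q (M + (N - n) + 1)"
    have "X \<subseteq> ?R" using X n by (fastforce simp: A_def)
    moreover have "{M<..<?h} \<subseteq> ?R"
      using n MX Mn by (auto simp: A_def intro!: bexI[of _ M])
    ultimately have "X \<union> {M<..<?h} \<subseteq> ?R" by blast
    then have "card (X \<union> {M<..<?h}) \<le> card ?R" by (rule card_mono[OF finR])
    moreover have "card (X \<union> {M<..<?h}) = card X + card {M<..<?h}"
      using Mx finX by (intro card_Un_disjoint) (auto simp: not_less[symmetric])
    ultimately show ?thesis using n Mn False by (auto simp: min_def split: if_splits)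
  qed
  finally show ?thesis .
qed

text \<open>Exchange argument: X has as many elements outside the initial segment as it misses
  inside, the former at least \<open>card X\<close>, the latter below it.\<close>

lemma sum_ge_initial:
  fixes X :: "nat set"
  assumes "finite X"
  shows "\<Sum>{..<card X} \<le> \<Sum>X"
    and "X \<noteq> {..<card X} \<Longrightarrow> \<Sum>{..<card X} < \<Sum>X"
proof -
  let ?I = "{..<card X}"
  have "card (?I - X) + card (?I \<inter> X) = card ?I" "card (X - ?I) + card (?I \<inter> X) = card X"
    using card_Diff_subset_Int[of ?I X] card_Diff_subset_Int[of X ?I]
      card_mono[of ?I "?I \<inter> X"] card_mono[of X "?I \<inter> X"] assms by (auto simp: Int_commute)
  then have c: "card (?I - X) = card (X - ?I)" by simp
  have I: "\<Sum>?I = \<Sum>(?I - X) + \<Sum>(?I \<inter> X)"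
    by (metis Int_Diff_disjoint Int_Diff_Un add.commute finite_Int finite_lessThan finite_Diff sum.union_disjoint)
  have XX: "\<Sum>X = \<Sum>(X - ?I) + \<Sum>(?I \<inter> X)"
    by (metis Int_Diff_disjoint Int_Diff_Un Int_commute add.commute assms finite_Int finite_Diff sum.union_disjoint)
  have lo: "card (X - ?I) * card X \<le> \<Sum>(X - ?I)"
    using sum_bounded_below[of "X - ?I" "card X" "\<lambda>x. x"] by auto
  have hi: "\<Sum>(?I - X) \<le> card (?I - X) * card X"
    using sum_bounded_above[of "?I - X" "\<lambda>x. x" "card X"] by auto
  show "\<Sum>?I \<le> \<Sum>X" using I XX lo hi c by simp
  assume "X \<noteq> ?I"
  then have "?I - X \<noteq> {}"
    using assms card_subset_eq[of X ?I] by (metis Diff_eq_empty_iff card_lessThan)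
  then have "\<Sum>(?I - X) < card (?I - X) * card X"
    using sum_bounded_above_strict[of "?I - X" "\<lambda>x. x" "card X"] by (auto simp: card_gt_0_iff)
  then show "\<Sum>?I < \<Sum>X" using I XX lo c by simp
qed

section \<open>Compression along one pair of adjacent variables\<close>

definition base :: "nat \<Rightarrow> (nat \<Rightarrow> nat) \<Rightarrow> nat \<Rightarrow> nat" where
  "base i a = a(i := 0, Suc i := 0)"

text \<open>In a fixed degree, b determines a line on which either of the two erased exponents is a
  coordinate. The same construction serves S in degree d and its multiples in degree e.\<close>

definition fibre :: "nat \<Rightarrow> (nat \<Rightarrow> nat) set \<Rightarrow> (nat \<Rightarrow> nat) \<Rightarrow> (nat \<Rightarrow> nat) set" where
  "fibre i S b = {a\<in>S. base i a = b}"

text \<open>Replaces every line of \<open>S\<close> in direction \<open>x\<^sub>i, x\<^sub>i\<^sub>+\<^sub>1\<close> by its lexicographically largest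
  elements, preserving the number of elements on the line.\<close>
definition compress :: "nat \<Rightarrow> nat \<Rightarrow> nat \<Rightarrow> (nat \<Rightarrow> nat) set \<Rightarrow> (nat \<Rightarrow> nat) set" where
  "compress m d i S = {a\<in>mons m d. a (Suc i) < card (fibre i S (base i a))}"

lemma sum_split_pair:
  fixes f :: "nat \<Rightarrow> nat"
  assumes "Suc i \<le> m"
  shows "(\<Sum>k\<le>m. f k) = (\<Sum>k\<in>{..m}-{i,Suc i}. f k) + f i + f (Suc i)"
proof -
  have "(\<Sum>k\<le>m. f k) = (\<Sum>k\<in>{..m}-{i,Suc i}. f k) + (\<Sum>k\<in>{i,Suc i}. f k)"
    by (rule sum.subset_diff) (use assms in auto)
  then show ?thesis by simp
qed

lemma base_eqD: "base i a = base i b \<Longrightarrow> k \<noteq> i \<Longrightarrow> k \<noteq> Suc i \<Longrightarrow> a k = b k"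
  unfolding base_def by (metis fun_upd_apply)

lemma base_upd [simp]: "base i (a(i := s, Suc i := t)) = base i a"
  by (auto simp: base_def)

lemma base_line_sum:
  assumes "a \<in> mons m d" "b \<in> mons m d" "base i a = base i b" "Suc i \<le> m"
  shows "a i + a (Suc i) = b i + b (Suc i)"
proof -
  have "(\<Sum>k\<in>{..m}-{i,Suc i}. a k) = (\<Sum>k\<in>{..m}-{i,Suc i}. b k)"
    by (rule sum.cong) (use base_eqD[OF assms(3)] in auto)
  then show ?thesis using assms(1,2) sum_split_pair[OF assms(4), of a] sum_split_pair[OF assms(4), of b]
    by (simp add: mons_def mdeg_def)
qed

lemma mons_line:
  assumes "a \<in> mons m d" "Suc i \<le> m" "s + t = a i + a (Suc i)"
  shows "a(i := s, Suc i := t) \<in> mons m d"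
proof -
  let ?b = "a(i := s, Suc i := t)"
  have "(\<Sum>k\<in>{..m}-{i,Suc i}. ?b k) = (\<Sum>k\<in>{..m}-{i,Suc i}. a k)"
    by (rule sum.cong) auto
  then show ?thesis using assms sum_split_pair[OF assms(2), of a] sum_split_pair[OF assms(2), of ?b]
    by (auto simp: mons_def mdeg_def)
qed

lemma line_eqI:
  assumes "a \<in> mons m d" "b \<in> mons m d" "base i a = base i b" "Suc i \<le> m"
    "a i = b i \<or> a (Suc i) = b (Suc i)"
  shows "a = b"
proof
  fix k show "a k = b k"
    using base_line_sum[OF assms(1-4)] assms(5) base_eqD[OF assms(3), of k] by fastforce
qed

lemma sum_fibres:
  fixes f :: "(nat \<Rightarrow> nat) \<Rightarrow> nat"
  assumes "S \<subseteq> mons m d"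
  shows "sum f S = (\<Sum>b\<in>base i ` mons m d. sum f (fibre i S b))"
  unfolding fibre_def
  by (rule sum.group[symmetric]) (use assms finite_mons finite_mons_subset in auto)

lemma card_fibres:
  assumes "S \<subseteq> mons m d"
  shows "card S = (\<Sum>b\<in>base i ` mons m d. card (fibre i S b))"
  using sum_fibres[OF assms, of "\<lambda>_. 1" i] by simp

lemma inj_on_fibre:
  assumes "S \<subseteq> mons m d" "Suc i \<le> m"
  shows "inj_on (\<lambda>a. a (Suc i)) (fibre i S b)" "inj_on (\<lambda>a. a i) (fibre i S b)"
  using assms line_eqI[of _ m d _ i] by (auto simp: inj_on_def fibre_def subset_iff)

lemma fibre_image_compress:
  assumes S: "S \<subseteq> mons m d" and i: "Suc i \<le> m"
  shows "(\<lambda>a. a (Suc i)) ` fibre i (compress m d i S) b = {..<card (fibre i S b)}"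
proof (intro equalityI subsetI)
  fix s assume "s \<in> (\<lambda>a. a (Suc i)) ` fibre i (compress m d i S) b"
  then show "s \<in> {..<card (fibre i S b)}" by (auto simp: fibre_def compress_def)
next
  fix s assume s: "s \<in> {..<card (fibre i S b)}"
  then have "fibre i S b \<noteq> {}" by auto
  then obtain a where a: "a \<in> S" "base i a = b" by (auto simp: fibre_def)
  have am: "a \<in> mons m d" using a S by auto
  let ?n = "a i + a (Suc i)"
  \<comment> \<open>A fibre has at most ?n + 1 elements, so every s below its size leaves a
    nonnegative exponent ?n - s for x_i.\<close>
  have "(\<lambda>a. a (Suc i)) ` fibre i S b \<subseteq> {..?n}"
  proof
    fix t assume "t \<in> (\<lambda>a. a (Suc i)) ` fibre i S b"
    then obtain c where "c \<in> S" "base i c = base i a" "t = c (Suc i)" using a by (auto simp: fibre_def)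
    then show "t \<in> {..?n}" using base_line_sum[of c m d a i] am S i by auto
  qed
  then have "card ((\<lambda>a. a (Suc i)) ` fibre i S b) \<le> card {..?n}" by (intro card_mono) auto
  then have "s \<le> ?n" using s by (simp add: card_image[OF inj_on_fibre(1)[OF S i]])
  then have "a(i := ?n - s, Suc i := s) \<in> mons m d" by (intro mons_line[OF am i]) simp
  then have "a(i := ?n - s, Suc i := s) \<in> fibre i (compress m d i S) b"
    using s a by (auto simp: fibre_def compress_def)
  then have "(a(i := ?n - s, Suc i := s)) (Suc i) \<in> (\<lambda>a. a (Suc i)) ` fibre i (compress m d i S) b"
    by (rule imageI)
  then show "s \<in> (\<lambda>a. a (Suc i)) ` fibre i (compress m d i S) b" by simp
qed

lemma compress_subset: "compress m d i S \<subseteq> mons m d"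
  by (auto simp: compress_def)

lemma card_fibre_compress:
  assumes "S \<subseteq> mons m d" "Suc i \<le> m"
  shows "card (fibre i (compress m d i S) b) = card (fibre i S b)"
  using card_image[OF inj_on_fibre(1)[OF compress_subset assms(2)], of d i S b]
    fibre_image_compress[OF assms, of b] by simp

lemma card_compress:
  assumes "S \<subseteq> mons m d" "Suc i \<le> m"
  shows "card (compress m d i S) = card S"
  using card_fibres[OF assms(1), of i] card_fibres[OF compress_subset, of m d i S i]
  by (simp add: card_fibre_compress[OF assms])

lemma wt_line:
  assumes "Suc i \<le> m"
  shows "wt m a = wt m (base i a) + i * (a i + a (Suc i)) + a (Suc i)"
proof -
  have "(\<Sum>k\<in>{..m}-{i,Suc i}. k * a k) = (\<Sum>k\<in>{..m}-{i,Suc i}. k * base i a k)"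
    by (rule sum.cong) (auto simp: base_def)
  then show ?thesis
    unfolding wt_def using sum_split_pair[OF assms, of "\<lambda>k. k * a k"] sum_split_pair[OF assms, of "\<lambda>k. k * base i a k"]
    by (simp add: base_def algebra_simps)
qed

lemma wt_fibre:
  assumes "S \<subseteq> mons m d" "Suc i \<le> m" "c \<in> mons m d"
  shows "sum (wt m) (fibre i S (base i c)) =
    card (fibre i S (base i c)) * (wt m (base i c) + i * (c i + c (Suc i)))
      + \<Sum>((\<lambda>a. a (Suc i)) ` fibre i S (base i c))"
proof -
  have "sum (wt m) (fibre i S (base i c)) =
      (\<Sum>a\<in>fibre i S (base i c). (wt m (base i c) + i * (c i + c (Suc i))) + a (Suc i))"
  proof (rule sum.cong[OF refl])
    fix a assume "a \<in> fibre i S (base i c)"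
    then have a: "a \<in> mons m d" "base i a = base i c" using assms(1) by (auto simp: fibre_def)
    show "wt m a = (wt m (base i c) + i * (c i + c (Suc i))) + a (Suc i)"
      using wt_line[OF assms(2), of a] base_line_sum[OF a(1) assms(3) a(2) assms(2)] a(2) by simp
  qed
  then show ?thesis
    by (simp add: sum.distrib sum.reindex[OF inj_on_fibre(1)[OF assms(1,2)]] distrib_left)
qed

text \<open>Along a line the weight is a constant plus the exponent of x_{i+1}. These exponents are
  distinct, so their sum is least exactly for an initial segment.\<close>

lemma wt_compress_less:
  assumes S: "S \<subseteq> mons m d" and i: "Suc i \<le> m" and ne: "compress m d i S \<noteq> S"
  shows "sum (wt m) (compress m d i S) < sum (wt m) S"
proof -
  let ?C = "compress m d i S"
  let ?B = "base i ` mons m d"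
  let ?im = "\<lambda>b. (\<lambda>a. a (Suc i)) ` fibre i S b"
  have fin: "finite (fibre i S b)" for b using finite_mons_subset[OF S] by (simp add: fibre_def)
  have card_im: "card (?im b) = card (fibre i S b)" for b
    by (rule card_image[OF inj_on_fibre(1)[OF S i]])
  have le: "sum (wt m) (fibre i ?C b) \<le> sum (wt m) (fibre i S b)"
    and lt: "?im b \<noteq> {..<card (fibre i S b)} \<Longrightarrow> sum (wt m) (fibre i ?C b) < sum (wt m) (fibre i S b)"
    if b: "b \<in> ?B" for b
  proof -
    obtain c where c: "c \<in> mons m d" "b = base i c" using b by blast
    have "\<Sum>{..<card (fibre i S b)} \<le> \<Sum>(?im b)"
      and "?im b \<noteq> {..<card (fibre i S b)} \<Longrightarrow> \<Sum>{..<card (fibre i S b)} < \<Sum>(?im b)"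
      using sum_ge_initial[of "?im b"] fin[of b] card_im[of b] by auto
    then show "sum (wt m) (fibre i ?C b) \<le> sum (wt m) (fibre i S b)"
      and "?im b \<noteq> {..<card (fibre i S b)} \<Longrightarrow> sum (wt m) (fibre i ?C b) < sum (wt m) (fibre i S b)"
      using wt_fibre[OF S i c(1)] wt_fibre[OF compress_subset i c(1), of i S] c(2)
        fibre_image_compress[OF S i, of b] card_fibre_compress[OF S i, of b] by simp_all
  qed
  have "\<exists>b\<in>?B. ?im b \<noteq> {..<card (fibre i S b)}"
  proof (rule ccontr)
    assume "\<not> ?thesis"
    then have all: "?im b = {..<card (fibre i S b)}" if "b \<in> ?B" for b using that by blast
    have "S \<subseteq> ?C"
    proof
      fix a assume a: "a \<in> S"
      then have "a (Suc i) \<in> ?im (base i a)" by (auto simp: fibre_def)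
      then show "a \<in> ?C" using all[of "base i a"] a S by (auto simp: compress_def)
    qed
    then have "S = ?C"
      using card_subset_eq[OF finite_mons_subset[OF compress_subset]] card_compress[OF S i] by metis
    with ne show False by simp
  qed
  then have "(\<Sum>b\<in>?B. sum (wt m) (fibre i ?C b)) < (\<Sum>b\<in>?B. sum (wt m) (fibre i S b))"
    using le lt by (intro sum_strict_mono_ex1) (auto simp: finite_mons)
  then show ?thesis using sum_fibres[OF S, of "wt m" i] sum_fibres[OF compress_subset, of "wt m" m d i S i]
    by simp
qed

text \<open>Trades the existential over the last variable for a condition on pairs, which is easy to
  check after two exponents change.\<close>

lemma Mbar_eq:
  assumes "0 < q"
  shows "Mbar q m e = {a\<in>mons m e. \<forall>j l. j < l \<longrightarrow> 0 < a l \<longrightarrow> a j < q}"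
proof (intro equalityI subsetI)
  fix a assume "a \<in> Mbar q m e"
  then have a: "a \<in> mons m e" "proj_reduced q m a" by (auto simp: Mbar_def mons_def)
  have "a j < q" if "j < l" "0 < a l" for j l
  proof -
    from a(2) that(2) obtain p where p: "\<forall>i>p. a i = 0" "\<forall>i<p. a i \<le> q - 1"
      unfolding proj_reduced_def by auto
    have "l \<le> p" using p(1) that(2) by (auto simp: not_less[symmetric])
    then have "a j \<le> q - 1" using p(2) that(1) by auto
    then show ?thesis using assms by simp
  qed
  with a show "a \<in> {a\<in>mons m e. \<forall>j l. j < l \<longrightarrow> 0 < a l \<longrightarrow> a j < q}" by simp
next
  fix a assume "a \<in> {a\<in>mons m e. \<forall>j l. j < l \<longrightarrow> 0 < a l \<longrightarrow> a j < q}"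
  then have a: "a \<in> mons m e" and r: "\<And>j l. j < l \<Longrightarrow> 0 < a l \<Longrightarrow> a j < q" by auto
  have "proj_reduced q m a"
  proof (cases "0 < a (mx a)")
    case True
    have "(\<forall>i>mx a. a i = 0) \<and> (\<forall>i<mx a. a i \<le> q - 1)"
      using mx_gt[OF a] r[OF _ True] by fastforce
    then show ?thesis using True mx_le[OF a] unfolding proj_reduced_def by blast
  next
    case False
    then have "a i = 0" for i
      using mx_gt[OF a, of i] mx_pos[OF a, of i] by (cases i "mx a" rule: linorder_cases) auto
    then show ?thesis by (simp add: proj_reduced_def)
  qed
  then show "a \<in> Mbar q m e" using a by (auto simp: Mbar_def mons_def)
qed

lemma Mbar_subset: "Mbar q m e \<subseteq> mons m e"
  by (auto simp: Mbar_def mons_def)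

lemma finite_Mbar: "finite (Mbar q m e)"
  using Mbar_subset finite_mons_subset by blast

lemma nabla_subset: "nabla q m e S \<subseteq> mons m e"
  using Mbar_subset by (auto simp: nabla_def)

text \<open>One line of S suffices: all compressed multiples lie at or above the lowest one \<mu>,
  and the fibre of S on the line of a single divisor \<nu> of \<mu> already supplies enough
  multiples.\<close>

lemma nabla_fibre_compress:
  assumes S: "S \<subseteq> mons m d" and d: "d < q" and i: "Suc i \<le> m"
  shows "card (fibre i (nabla q m e (compress m d i S)) b) \<le> card (fibre i (nabla q m e S) b)"
proof (cases "fibre i (nabla q m e (compress m d i S)) b = {}")
  case True
  then show ?thesis by simp
next
  case False
  let ?F' = "fibre i (nabla q m e (compress m d i S)) b"
  let ?F = "fibre i (nabla q m e S) b"
  have q: "0 < q" using d by simp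
  obtain \<mu> where \<mu>F: "\<mu> \<in> ?F'" and min: "\<And>\<mu>'. \<mu>' \<in> ?F' \<Longrightarrow> \<mu> i \<le> \<mu>' i"
    using ex_has_least_nat[of "\<lambda>\<mu>. \<mu> \<in> ?F'" _ "\<lambda>\<mu>. \<mu> i"] False by blast
  have \<mu>M: "\<mu> \<in> Mbar q m e" and \<mu>b: "base i \<mu> = b" using \<mu>F by (auto simp: fibre_def nabla_def)
  have \<mu>m: "\<mu> \<in> mons m e" using \<mu>M Mbar_subset by blast
  obtain \<nu> where \<nu>: "\<nu> \<in> compress m d i S" "mdvd \<nu> \<mu>" using \<mu>F by (auto simp: fibre_def nabla_def)
  have \<nu>m: "\<nu> \<in> mons m d" using \<nu> by (auto simp: compress_def)
  define N where "N = \<mu> i + \<mu> (Suc i)"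
  define n where "n = \<nu> i + \<nu> (Suc i)"
  define T where "T = fibre i S (base i \<nu>)"
  define X where "X = (\<lambda>a. a i) ` T"
  have cX: "card X = card T" unfolding X_def T_def by (rule card_image[OF inj_on_fibre(2)[OF S i]])
  have \<nu>k: "\<nu> (Suc i) < card X" using \<nu> by (auto simp: compress_def cX T_def)
  then have Xne: "X \<noteq> {}" by auto
  have Tsum: "a i + a (Suc i) = n" if "a \<in> T" for a
    using that S base_line_sum[of a m d \<nu> i] \<nu>m i by (auto simp: T_def fibre_def n_def)
  have Xn: "X \<subseteq> {..n}" using Tsum by (force simp: X_def)
  have nN: "n \<le> N" using \<nu>(2) by (auto simp: mdvd_def n_def N_def intro: add_mono)
  have nq: "n < q"
  proof -
    have "n \<le> mdeg m \<nu>" using sum_split_pair[OF i, of \<nu>] by (simp add: mdeg_def n_def)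
    then show ?thesis using \<nu>m d by (simp add: mons_def)
  qed
  define pt where "pt = (\<lambda>s. \<mu>(i := s, Suc i := N - s))"
  define A where "A = {s. s \<le> N \<and> pt s \<in> Mbar q m e}"
  have finA: "finite A" unfolding A_def by simp
  have ptm: "pt s \<in> mons m e" if "s \<le> N" for s
    unfolding pt_def by (rule mons_line[OF \<mu>m i]) (use that in \<open>simp add: N_def\<close>)
  have pt_inj: "inj pt" unfolding pt_def
    by (rule injI) (metis fun_upd_apply n_not_Suc_n)
  have rep: "\<mu>' = pt (\<mu>' i) \<and> \<mu>' i \<le> N" if "\<mu>' \<in> mons m e" "base i \<mu>' = b" for \<mu>'
  proof -
    have "\<mu>' i + \<mu>' (Suc i) = N"
      using base_line_sum[OF that(1) \<mu>m _ i] that(2) \<mu>b by (simp add: N_def)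
    moreover then have "\<mu>' = pt (\<mu>' i)"
      using ptm[of "\<mu>' i"] that \<mu>b by (intro line_eqI[OF that(1) _ _ i]) (auto simp: pt_def)
    ultimately show ?thesis by simp
  qed
  have "?F' \<subseteq> pt ` {s\<in>A. n + 1 - card X \<le> s}"
  proof
    fix \<mu>' assume F: "\<mu>' \<in> ?F'"
    then have M: "\<mu>' \<in> Mbar q m e" "base i \<mu>' = b" by (auto simp: fibre_def nabla_def)
    note r = rep[OF subsetD[OF Mbar_subset M(1)] M(2)]
    have "\<nu> i \<le> \<mu>' i" using min[OF F] \<nu>(2) by (auto simp: mdvd_def intro: order_trans)
    \<comment> \<open>Membership of \<nu> in the compression bounds its exponent of x_{i+1} by |X| -
      1, hence its exponent of x_i from below.\<close>
    then have "n + 1 - card X \<le> \<mu>' i" using \<nu>k by (simp add: n_def)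
    then have "\<mu>' i \<in> {s\<in>A. n + 1 - card X \<le> s}" using r M(1) by (auto simp: A_def)
    then show "\<mu>' \<in> pt ` {s\<in>A. n + 1 - card X \<le> s}" using r by blast
  qed
  then have "card ?F' \<le> card (pt ` {s\<in>A. n + 1 - card X \<le> s})" using finA by (intro card_mono) auto
  also have "\<dots> = card {s\<in>A. n + 1 - card X \<le> s}"
    by (rule card_image[OF inj_on_subset[OF pt_inj]]) simp
  also have "\<dots> \<le> card {s\<in>A. \<exists>x\<in>X. x \<le> s \<and> s \<le> x + (N - n)}"
  proof -
    have red: "\<mu> j < q" if "j < l" "0 < \<mu> l" for j l using \<mu>M that by (auto simp: Mbar_eq[OF q])
    have ptM: "pt s \<in> Mbar q m e \<longleftrightarrow> (\<forall>j l. j < l \<longrightarrow> 0 < pt s l \<longrightarrow> pt s j < q)" if "s \<le> N" for s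
      using ptm[OF that] by (auto simp: Mbar_eq[OF q])
    show ?thesis
    \<comment> \<open>A variable beyond x_{i+1} caps both exponents; without one, x_{i+1} is
      uncapped and x_i is uncapped at s = N. These are the ranges of the two interval
      lemmas.\<close>
    proof (cases "\<exists>l>Suc i. 0 < \<mu> l")
      case True
      then obtain l where l: "l > Suc i" "0 < \<mu> l" by blast
      have "A = {s. s \<le> N \<and> s < q \<and> N - s < q}"
      proof (intro equalityI subsetI)
        fix s assume "s \<in> A"
        then have s: "s \<le> N" "\<And>j l. j < l \<Longrightarrow> 0 < pt s l \<Longrightarrow> pt s j < q" using ptM by (auto simp: A_def)
        have "pt s l = \<mu> l" "pt s i = s" "pt s (Suc i) = N - s" using l by (auto simp: pt_def)
        then show "s \<in> {s. s \<le> N \<and> s < q \<and> N - s < q}"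
          using s(1) s(2)[of i l] s(2)[of "Suc i" l] l by auto
      next
        fix s assume "s \<in> {s. s \<le> N \<and> s < q \<and> N - s < q}"
        then have s: "s \<le> N" "s < q" "N - s < q" by auto
        have "pt s j < q" if "j < k" "0 < pt s k" for j k
        proof (cases "j = i \<or> j = Suc i")
          case True then show ?thesis using s by (auto simp: pt_def)
        next
          case False
          then have pj: "pt s j = \<mu> j" by (simp add: pt_def)
          show ?thesis
          proof (cases "k = i \<or> k = Suc i")
            case True
            then have "j < l" using that l by auto
            then show ?thesis using pj red l by simp
          next
            case False
            then show ?thesis using pj red[OF that(1)] that(2) by (simp add: pt_def)
          qed
        qed
        then show "s \<in> A" using ptM s(1) by (auto simp: A_def)
      qed
      then show ?thesis using card_interval_chain[OF Xn Xne nq nN] by simp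
    next
      case False
      then have z: "\<mu> l = 0" if "l > Suc i" for l using that by auto
      have "A = {s. s \<le> N \<and> (s < q \<or> s = N)}"
      proof (intro equalityI subsetI)
        fix s assume "s \<in> A"
        then have s: "s \<le> N" "\<And>j l. j < l \<Longrightarrow> 0 < pt s l \<Longrightarrow> pt s j < q" using ptM by (auto simp: A_def)
        have "pt s i = s" "pt s (Suc i) = N - s" by (auto simp: pt_def)
        then show "s \<in> {s. s \<le> N \<and> (s < q \<or> s = N)}"
          using s(1) s(2)[of i "Suc i"] by auto
      next
        fix s assume "s \<in> {s. s \<le> N \<and> (s < q \<or> s = N)}"
        then have s: "s \<le> N" "s < q \<or> s = N" by auto
        have "pt s j < q" if "j < k" "0 < pt s k" for j k
        proof -
          have k: "k \<le> Suc i" using that(2) z by (auto simp: pt_def not_less[symmetric] split: if_splits)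
          show ?thesis
          proof (cases "j = i")
            case True
            then have "k = Suc i" using k that by simp
            then have "s \<noteq> N" using that(2) by (auto simp: pt_def)
            then show ?thesis using s True by (auto simp: pt_def)
          next
            case False
            then have ji: "j < i" using k that(1) by simp
            then have pj: "pt s j = \<mu> j" by (simp add: pt_def)
            show ?thesis
            proof (cases "k = i \<or> k = Suc i")
              case True
              then have "0 < N" using that(2) s(1) by (auto simp: pt_def split: if_splits)
              then have "0 < \<mu> i \<or> 0 < \<mu> (Suc i)" by (simp add: N_def)
              then show ?thesis using red[of j i] red[of j "Suc i"] ji pj by auto
            next
              case False
              then show ?thesis using pj red[OF that(1)] that(2) by (simp add: pt_def)
            qed
          qed
        qed
        then show "s \<in> A" using ptM s(1) by (auto simp: A_def)
      qed
      then show ?thesis using card_interval_top_chain[OF Xn Xne nq nN] by simp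
    qed
  qed
  also have "\<dots> = card (pt ` {s\<in>A. \<exists>x\<in>X. x \<le> s \<and> s \<le> x + (N - n)})"
    by (rule card_image[OF inj_on_subset[OF pt_inj], symmetric]) simp
  also have "\<dots> \<le> card ?F"
  proof (rule card_mono)
    show "finite ?F" using finite_mons_subset[OF nabla_subset] by (simp add: fibre_def)
    show "pt ` {s\<in>A. \<exists>x\<in>X. x \<le> s \<and> s \<le> x + (N - n)} \<subseteq> ?F"
    proof
      fix \<mu>' assume "\<mu>' \<in> pt ` {s\<in>A. \<exists>x\<in>X. x \<le> s \<and> s \<le> x + (N - n)}"
      then obtain s a where s: "\<mu>' = pt s" "s \<le> N" "pt s \<in> Mbar q m e" "a \<in> T" "a i \<le> s" "s \<le> a i + (N - n)"
        by (auto simp: A_def X_def)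
      have a: "a \<in> S" "base i a = base i \<nu>" using s(4) by (auto simp: T_def fibre_def)
      have "mdvd a (pt s)"
        unfolding mdvd_def
      proof
        fix k show "a k \<le> pt s k"
        proof (cases "k = i \<or> k = Suc i")
          case True
          then show ?thesis using s Tsum[OF s(4)] nN by (auto simp: pt_def)
        next
          case False
          then show ?thesis using base_eqD[OF a(2), of k] \<nu>(2) by (auto simp: mdvd_def pt_def)
        qed
      qed
      then show "\<mu>' \<in> ?F" using s a \<mu>b by (auto simp: fibre_def nabla_def pt_def)
    qed
  qed
  finally show ?thesis .
qed

lemma card_nabla_compress:
  assumes "S \<subseteq> mons m d" "d < q" "Suc i \<le> m"
  shows "card (nabla q m e (compress m d i S)) \<le> card (nabla q m e S)"
  unfolding card_fibres[OF nabla_subset, of _ _ _ _ i]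
  by (rule sum_mono) (rule nabla_fibre_compress[OF assms])

text \<open>A set of least total weight among the competitors is fixed by every compression. Being
  fixed gives stability: an adjacent move lowers the exponent of x_{i+1} on the line, so it stays
  below the fibre size.\<close>

lemma exists_strongly_stable:
  assumes "S \<subseteq> mons m d" "d < q"
  obtains T where "T \<subseteq> mons m d" "card T = card S" "strongly_stable T"
    "card (nabla q m e T) \<le> card (nabla q m e S)"
proof -
  let ?P = "\<lambda>T. T \<subseteq> mons m d \<and> card T = card S \<and> card (nabla q m e T) \<le> card (nabla q m e S)"
  obtain T where T: "?P T" and min: "\<And>T'. ?P T' \<Longrightarrow> sum (wt m) T \<le> sum (wt m) T'"
    using ex_has_least_nat[of ?P S "sum (wt m)"] assms by blast
  have fix_: "compress m d i T = T" if "Suc i \<le> m" for i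
  proof (rule ccontr)
    assume "compress m d i T \<noteq> T"
    then have "sum (wt m) (compress m d i T) < sum (wt m) T"
      using wt_compress_less T that by blast
    moreover have "?P (compress m d i T)"
      using T card_compress[of T m d i] card_nabla_compress[of T m d q i e] that assms(2)
        compress_subset[of m d i T] by auto
    ultimately show False using min by (meson not_less)
  qed
  have "strongly_stable T"
    unfolding strongly_stable_def
  proof (intro ballI allI impI)
    fix a i assume a: "a \<in> T" and p: "0 < a (Suc i)"
    have am: "a \<in> mons m d" using a T by auto
    have i: "Suc i \<le> m" using mons_pos_le[OF am p] .
    let ?b = "a(i := a i + 1, Suc i := a (Suc i) - 1)"
    have "?b \<in> mons m d" using mons_move[OF am _ p, of i] by simp
    moreover have "a (Suc i) < card (fibre i T (base i a))"
      using a fix_[OF i] by (auto simp: compress_def)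
    ultimately have "?b \<in> compress m d i T" by (auto simp: compress_def)
    then show "?b \<in> T" using fix_[OF i] by simp
  qed
  with T that show ?thesis by blast
qed

section \<open>Counting reduced multiples\<close>

text \<open>One monomial ends in x_p itself, and (q - c) q^(l-p-1) end in each later x_l; p is the
  last variable of \<nu> and c its exponent.\<close>

definition cone_size :: "nat \<Rightarrow> nat \<Rightarrow> nat \<Rightarrow> nat \<Rightarrow> nat" where
  "cone_size q m p c = Suc ((q - c) * (\<Sum>k<m - p. q ^ k))"

lemma sum_powers_Suc: "(\<Sum>k<Suc n. q ^ k) = Suc (q * (\<Sum>k<n. q ^ k :: nat))"
  by (subst sum.lessThan_Suc_shift) (simp add: sum_distrib_left)

text \<open>For p < p' the later piece has at most 1 + q + ... + q^(m-p') elements. Since m - p' < m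
  - p, this is within a single copy of the geometric sum, and q - c >= 1 copies are
  available.\<close>

lemma cone_size_antimono:
  assumes "p < p' \<or> p = p' \<and> c \<le> c'" "c < q" "p' \<le> m"
  shows "cone_size q m p' c' \<le> cone_size q m p c"
proof (cases "p = p'")
  case True
  then show ?thesis using assms by (auto simp: cone_size_def)
next
  case False
  then have p: "p < p'" using assms by auto
  have "cone_size q m p' c' \<le> Suc (q * (\<Sum>k<m - p'. q ^ k))" by (simp add: cone_size_def)
  also have "\<dots> = (\<Sum>k<Suc (m - p'). q ^ k)" by (rule sum_powers_Suc[symmetric])
  also have "\<dots> \<le> (\<Sum>k<m - p. q ^ k)" using p assms(3) by (intro sum_mono2) auto
  also have "\<dots> \<le> (q - c) * (\<Sum>k<m - p. q ^ k)"
    using mult_le_mono1[of 1 "q - c" "\<Sum>k<m - p. q ^ k"] assms(2) by linarith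
  also have "\<dots> \<le> cone_size q m p c" by (simp add: cone_size_def)
  finally show ?thesis .
qed

lemma mons_sum_upto:
  assumes "a \<in> mons m d" "mx a \<le> l"
  shows "(\<Sum>i\<le>l. a i) = d"
proof -
  have "(\<Sum>i\<le>l. a i) = (\<Sum>i\<le>mx a. a i)"
    by (rule sum.mono_neutral_right) (use assms mx_gt[OF assms(1)] in auto)
  moreover have "(\<Sum>i\<le>m. a i) = (\<Sum>i\<le>mx a. a i)"
    by (rule sum.mono_neutral_right) (use mx_le[OF assms(1)] mx_gt[OF assms(1)] in auto)
  ultimately show ?thesis using assms(1) by (simp add: mons_def mdeg_def)
qed

lemma mons_upto:
  assumes "\<And>i. l < i \<Longrightarrow> a i = 0" "l \<le> m"
  shows "a \<in> mons m (\<Sum>i\<le>l. a i)"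
proof -
  have "(\<Sum>i\<le>m. a i) = (\<Sum>i\<le>l. a i)"
    by (rule sum.mono_neutral_right) (use assms in auto)
  then show ?thesis using assms by (auto simp: mons_def mdeg_def)
qed

lemma mx_eqI:
  assumes "a \<in> mons m d" "0 < a l" "\<And>i. l < i \<Longrightarrow> a i = 0"
  shows "mx a = l"
proof (rule antisym)
  show "mx a \<le> l" using mx_le_iff[OF assms(1)] assms(3) by blast
  show "l \<le> mx a" using mx_gt[OF assms(1), of l] assms(2) by (auto simp: not_less[symmetric])
qed

text \<open>Exponents strictly between the last variable of \<nu> and x_l range freely below q, the
  one at the last variable of \<nu> starts at its value in \<nu>, and x_l takes the rest of the
  degree, positive because e > m*q.\<close>

lemma card_Mbar_cone_level:
  assumes \<nu>: "\<nu> \<in> mons m d" and d: "d < q" and e: "m * q < e" and l: "mx \<nu> < l" "l \<le> m"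
  shows "card {\<mu>\<in>Mbar q m e \<inter> cone \<nu>. mx \<mu> = l} = (q - \<nu> (mx \<nu>)) * q ^ (l - Suc (mx \<nu>))"
proof -
  let ?p = "mx \<nu>"
  let ?B = "\<lambda>i. if i = ?p then {\<nu> ?p..<q} else {..<q}"
  let ?X = "{\<mu>\<in>Mbar q m e \<inter> cone \<nu>. mx \<mu> = l}"
  have q: "0 < q" using d by simp
  have \<nu>q: "\<nu> i < q" for i using mons_le[OF \<nu>, of i] d by simp
  have "bij_betw (\<lambda>\<mu>. restrict \<mu> {?p..<l}) ?X (PiE {?p..<l} ?B)"
  proof (rule bij_betw_imageI)
    show "inj_on (\<lambda>\<mu>. restrict \<mu> {?p..<l}) ?X"
    proof (rule inj_onI)
      fix \<mu> \<mu>' assume m: "\<mu> \<in> ?X" "\<mu>' \<in> ?X" and eq: "restrict \<mu> {?p..<l} = restrict \<mu>' {?p..<l}"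
      have mm: "\<mu> \<in> mons m e" "\<mu>' \<in> mons m e" using m Mbar_subset by blast+
      have lt: "\<mu> i = \<mu>' i" if "i < l" for i
      proof (cases "i < ?p")
        case True then show ?thesis using m by (auto simp: cone_def)
      next
        case False
        then show ?thesis using fun_cong[OF eq, of i] that by (auto simp: restrict_def)
      qed
      have "(\<Sum>i<l. \<mu> i) = (\<Sum>i<l. \<mu>' i)" by (rule sum.cong) (use lt in auto)
      moreover have "(\<Sum>i<l. \<mu> i) + \<mu> l = e" "(\<Sum>i<l. \<mu>' i) + \<mu>' l = e"
        using mons_sum_upto[OF mm(1), of l] mons_sum_upto[OF mm(2), of l] m
        by (auto simp: lessThan_Suc_atMost[symmetric])
      ultimately have "\<mu> l = \<mu>' l" by simp
      moreover have "\<mu> i = 0" "\<mu>' i = 0" if "l < i" for i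
        using mx_gt[OF mm(1), of i] mx_gt[OF mm(2), of i] m that by auto
      ultimately show "\<mu> = \<mu>'" using lt by (metis ext linorder_neqE_nat)
    qed
    show "(\<lambda>\<mu>. restrict \<mu> {?p..<l}) ` ?X = PiE {?p..<l} ?B"
    proof (intro equalityI subsetI)
      fix f assume "f \<in> (\<lambda>\<mu>. restrict \<mu> {?p..<l}) ` ?X"
      then obtain \<mu> where \<mu>: "\<mu> \<in> Mbar q m e" "\<mu> \<in> cone \<nu>" "mx \<mu> = l" "f = restrict \<mu> {?p..<l}" by auto
      have mm: "\<mu> \<in> mons m e" using \<mu> Mbar_subset by blast
      have "\<mu> i < q" if "i < l" for i
        using \<mu> that mx_pos[OF mm, of i] by (auto simp: Mbar_eq[OF q])
      then show "f \<in> PiE {?p..<l} ?B" using \<mu> by (auto simp: cone_def)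
    next
      fix f assume f: "f \<in> PiE {?p..<l} ?B"
      have fq: "f i < q" if "?p \<le> i" "i < l" for i
        using PiE_mem[OF f, of i] that by (auto split: if_splits)
      define g where "g = (\<lambda>i. if i < ?p then \<nu> i else f i)"
      have gq: "g i < q" if "i < l" for i using that \<nu>q fq by (auto simp: g_def)
      have "(\<Sum>i<l. g i) \<le> (\<Sum>i<l. q)" by (intro sum_mono) (use gq in \<open>auto intro: less_imp_le\<close>)
      also have "\<dots> \<le> m * q" using l by simp
      finally have small: "(\<Sum>i<l. g i) < e" using e by simp
      define \<mu> where "\<mu> = (\<lambda>i. if i < l then g i else if i = l then e - (\<Sum>i<l. g i) else 0)"
      have "(\<Sum>i\<le>l. \<mu> i) = (\<Sum>i<l. \<mu> i) + \<mu> l" by (simp add: lessThan_Suc_atMost[symmetric])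
      also have "(\<Sum>i<l. \<mu> i) = (\<Sum>i<l. g i)" by (rule sum.cong) (auto simp: \<mu>_def)
      finally have se: "(\<Sum>i\<le>l. \<mu> i) = e" using small by (simp add: \<mu>_def)
      have mm: "\<mu> \<in> mons m e" using mons_upto[of l \<mu> m] l se by (auto simp: \<mu>_def)
      have mx: "mx \<mu> = l" by (rule mx_eqI[OF mm]) (use small in \<open>auto simp: \<mu>_def\<close>)
      have "\<mu> j < q" if "j < k" "0 < \<mu> k" for j k
      proof -
        have "k \<le> l" using that(2) by (auto simp: \<mu>_def split: if_splits)
        then show ?thesis using gq that by (auto simp: \<mu>_def)
      qed
      then have "\<mu> \<in> Mbar q m e" using mm by (auto simp: Mbar_eq[OF q])
      moreover have "\<mu> \<in> cone \<nu>"
        using PiE_mem[OF f, of ?p] l by (auto simp: cone_def \<mu>_def g_def)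
      moreover have "f = restrict \<mu> {?p..<l}"
      proof
        fix i show "f i = restrict \<mu> {?p..<l} i"
          using PiE_arb[OF f, of i] by (auto simp: restrict_def \<mu>_def g_def)
      qed
      ultimately show "f \<in> (\<lambda>\<mu>. restrict \<mu> {?p..<l}) ` ?X" using mx by blast
    qed
  qed
  then have "card ?X = card (PiE {?p..<l} ?B)" by (rule bij_betw_same_card)
  also have "\<dots> = (\<Prod>i\<in>{?p..<l}. card (?B i))" by (rule card_PiE) simp
  also have "\<dots> = card (?B ?p) * (\<Prod>i\<in>{Suc ?p..<l}. card (?B i))"
    using l by (simp only: prod.atLeast_Suc_lessThan[OF l(1)])
  also have "(\<Prod>i\<in>{Suc ?p..<l}. card (?B i)) = (\<Prod>i\<in>{Suc ?p..<l}. q)"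
    by (rule prod.cong) auto
  finally show ?thesis by simp
qed

lemma card_Mbar_cone:
  assumes \<nu>: "\<nu> \<in> mons m d" and d: "d < q" "0 < d" and e: "m * q + q < e"
  shows "card (Mbar q m e \<inter> cone \<nu>) = cone_size q m (mx \<nu>) (\<nu> (mx \<nu>))"
proof -
  let ?p = "mx \<nu>"
  let ?E = "Mbar q m e \<inter> cone \<nu>"
  have q: "0 < q" using d by simp
  have pm: "?p \<le> m" by (rule mx_le[OF \<nu>])
  \<comment> \<open>Positive degree excludes \<nu> = 1; hence every element of the cone ends at x_p
    or later.\<close>
  have pos: "0 < \<nu> ?p"
  proof (cases "?p = 0")
    case True
    then show ?thesis using mons_sum_upto[OF \<nu>, of 0] d by simp
  qed (use mx_pos[OF \<nu>, of 0] in auto)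
  have fin: "finite ?E" using finite_Mbar by blast
  have Em: "\<mu> \<in> mons m e" if "\<mu> \<in> ?E" for \<mu> using that Mbar_subset by blast
  have mxE: "?p \<le> mx \<mu>" "mx \<mu> \<le> m" if "\<mu> \<in> ?E" for \<mu>
    using that pos mx_gt[OF Em[OF that], of ?p] mx_le[OF Em[OF that]]
    by (auto simp: cone_def not_less[symmetric])
  have "card ?E = (\<Sum>l\<in>{?p..m}. card {\<mu>\<in>?E. mx \<mu> = l})"
  proof -
    have "mx ` ?E \<subseteq> {?p..m}" using mxE by fastforce
    then show ?thesis using sum.group[OF fin finite_atLeastAtMost, of mx ?p m "\<lambda>_. 1::nat"] by simp
  qed
  also have "\<dots> = card {\<mu>\<in>?E. mx \<mu> = ?p} + (\<Sum>l\<in>{Suc ?p..m}. card {\<mu>\<in>?E. mx \<mu> = l})"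
    by (rule sum.atLeast_Suc_atMost[OF pm])
  also have "(\<Sum>l\<in>{Suc ?p..m}. card {\<mu>\<in>?E. mx \<mu> = l})
      = (\<Sum>l\<in>{Suc ?p..m}. (q - \<nu> ?p) * q ^ (l - Suc ?p))"
    by (rule sum.cong[OF refl], rule card_Mbar_cone_level[OF \<nu> d(1)]) (use e in auto)
  also have "\<dots> = (q - \<nu> ?p) * (\<Sum>k<m - ?p. q ^ k)"
    unfolding sum_distrib_left[symmetric]
    by (intro arg_cong[where f = "(*) (q - \<nu> ?p)"] sum.reindex_bij_witness[of _ "\<lambda>k. k + Suc ?p" "\<lambda>l. l - Suc ?p"])
      auto
  \<comment> \<open>All exponents before x_p are fixed, so the degree forces that of x_p. It may
    exceed q, being the last.\<close>
  also have "card {\<mu>\<in>?E. mx \<mu> = ?p} = 1"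
  proof -
    define s where "s = (\<Sum>i<?p. \<nu> i)"
    have sd: "s + \<nu> ?p = d"
      using mons_sum_upto[OF \<nu>, of ?p] by (simp add: lessThan_Suc_atMost[symmetric] s_def)
    define \<mu> where "\<mu> = \<nu>(?p := e - s)"
    have se: "s < e" "\<nu> ?p \<le> e - s" using sd d e by auto
    have "(\<Sum>i\<le>?p. \<mu> i) = (\<Sum>i<?p. \<mu> i) + \<mu> ?p" by (simp add: lessThan_Suc_atMost[symmetric])
    also have "(\<Sum>i<?p. \<mu> i) = s" unfolding s_def by (rule sum.cong) (auto simp: \<mu>_def)
    finally have "(\<Sum>i\<le>?p. \<mu> i) = e" using se by (simp add: \<mu>_def)
    then have mm: "\<mu> \<in> mons m e" using mons_upto[of ?p \<mu> m] pm mx_gt[OF \<nu>] by (auto simp: \<mu>_def)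
    have mx: "mx \<mu> = ?p" by (rule mx_eqI[OF mm]) (use se mx_gt[OF \<nu>] in \<open>auto simp: \<mu>_def\<close>)
    have "\<mu> j < q" if "j < k" "0 < \<mu> k" for j k
    proof -
      have "k \<le> ?p" using that(2) mx_gt[OF mm, of k] mx by (auto simp: not_less[symmetric])
      then show ?thesis using that(1) mons_le[OF \<nu>, of j] d by (auto simp: \<mu>_def)
    qed
    then have \<mu>: "\<mu> \<in> {\<mu>\<in>?E. mx \<mu> = ?p}"
      using mm mx se by (auto simp: Mbar_eq[OF q] cone_def \<mu>_def)
    have "\<mu>' = \<mu>" if "\<mu>' \<in> {\<mu>\<in>?E. mx \<mu> = ?p}" for \<mu>'
    proof
      fix i
      have m': "\<mu>' \<in> mons m e" "mx \<mu>' = ?p" "\<mu>' \<in> cone \<nu>" using that Em by auto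
      have "(\<Sum>i<?p. \<mu>' i) = s" unfolding s_def by (rule sum.cong) (use m' in \<open>auto simp: cone_def\<close>)
      then have "\<mu>' ?p = e - s"
        using mons_sum_upto[OF m'(1), of ?p] m' by (simp add: lessThan_Suc_atMost[symmetric])
      then show "\<mu>' i = \<mu> i"
        using m' mx_gt[OF m'(1), of i] mx_gt[OF \<nu>, of i]
        by (cases i ?p rule: linorder_cases) (auto simp: cone_def \<mu>_def)
    qed
    then have "{\<mu>\<in>?E. mx \<mu> = ?p} = {\<mu>}" using \<mu> by blast
    then show ?thesis by (metis card_1_singleton_iff One_nat_def)
  qed
  finally show ?thesis by (simp add: cone_size_def)
qed

text \<open>Both counts are sums of \<open>cone_size\<close>, whose superlevel sets are initial
  segments of the pairs (last variable, exponent); \<open>stable_count_ge_lexseg\<close> compares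
  them layer by layer.\<close>

lemma strongly_stable_nabla_ge:
  assumes S: "S \<subseteq> mons m d" "strongly_stable S" and L: "lexseg m d L" "card L = card S"
    and d: "d < q" "0 < d" and e: "m * q + q < e"
  shows "card (nabla q m e L) \<le> card (nabla q m e S)"
proof -
  define w where "w = (\<lambda>\<nu>. cone_size q m (mx \<nu>) (\<nu> (mx \<nu>)))"
  have Lm: "L \<subseteq> mons m d" using L by (simp add: lexseg_def)
  have count: "card (nabla q m e T) = sum w T" if "T \<subseteq> mons m d" "strongly_stable T" for T
    unfolding nabla_def stable_card_multiples[OF that(2,1) finite_Mbar] w_def
    by (intro sum.cong refl card_Mbar_cone[OF _ d e]) (use that in blast)
  have "sum w L \<le> sum w S"
  proof (rule sum_le_by_layers)
    fix k
    let ?W = "{a\<in>mons m d. k < w a}"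
    show "card {x \<in> L. k < w x} \<le> card {x \<in> S. k < w x}"
    proof (cases "?W = {}")
      case True
      then have "{x \<in> L. k < w x} = {}" using Lm by blast
      then show ?thesis by (simp only: card.empty)
    next
      case False
      \<comment> \<open>Encodes the pair as one number, faithfully to the lexicographic order
        because exponents are below q. The greatest key in the layer, attained at z, describes the
        whole layer.\<close>
      let ?key = "\<lambda>a. mx a * q + a (mx a)"
      have finW: "finite ?W" using finite_mons by simp
      obtain z where z: "z \<in> ?W" and zmax: "\<And>a. a \<in> ?W \<Longrightarrow> ?key a \<le> ?key z"
      proof -
        have "Max (?key ` ?W) \<in> ?key ` ?W" using finW False by (intro Max_in) auto
        then obtain z where "z \<in> ?W" "Max (?key ` ?W) = ?key z" by blast
        moreover have "?key a \<le> Max (?key ` ?W)" if "a \<in> ?W" for a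
          using finW that by (intro Max_ge) auto
        ultimately show ?thesis by (intro that[of z]) auto
      qed
      have zm: "z \<in> mons m d" using z by simp
      have lt: "a (mx a) < q" if "a \<in> mons m d" for a using mons_le[OF that, of "mx a"] d by simp
      have W: "k < w a \<longleftrightarrow> (\<forall>i>mx z. a i = 0) \<and> a (mx z) \<le> z (mx z)" if a: "a \<in> mons m d" for a
      proof
        assume "k < w a"
        then have key: "?key a \<le> ?key z" using zmax a by simp
        have "mx a < mx z \<or> mx a = mx z \<and> a (mx a) \<le> z (mx z)"
        proof (cases "mx a" "mx z" rule: linorder_cases)
          case greater
          then have "Suc (mx z) * q \<le> mx a * q" by (intro mult_right_mono) auto
          then show ?thesis using key lt[OF zm] by simp
        qed (use key in auto)
        then show "(\<forall>i>mx z. a i = 0) \<and> a (mx z) \<le> z (mx z)"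
          using mx_gt[OF a] by auto
      next
        assume r: "(\<forall>i>mx z. a i = 0) \<and> a (mx z) \<le> z (mx z)"
        then have "mx a \<le> mx z" using mx_le_iff[OF a] by blast
        then have "mx a < mx z \<or> mx a = mx z \<and> a (mx a) \<le> z (mx z)" using r by auto
        then have "w z \<le> w a" unfolding w_def
          by (rule cone_size_antimono) (use lt[OF a] mx_le[OF zm] in auto)
        then show "k < w a" using z by simp
      qed
      have "{x \<in> T. k < w x} = {a\<in>T. (\<forall>i>mx z. a i = 0) \<and> a (mx z) \<le> z (mx z)}" if "T \<subseteq> mons m d" for T
        using W that by blast
      then show ?thesis
        using stable_count_ge_lexseg[OF S L(1) _ mx_le[OF zm]] L(2) S(1) Lm by simp
    qed
  qed (use S Lm finite_mons_subset in auto)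
  then show ?thesis using count S Lm stable_lexseg[OF L(1)] by simp
qed

lemma card_nabla_lexseg_le:
  assumes "S \<subseteq> mons m d" "lexseg m d L" "card L = card S" "d < q" "0 < d" "m * q + q < e"
  shows "card (nabla q m e L) \<le> card (nabla q m e S)"
proof -
  obtain T where T: "T \<subseteq> mons m d" "card T = card S" "strongly_stable T"
    "card (nabla q m e T) \<le> card (nabla q m e S)"
    using exists_strongly_stable[OF assms(1,4)] by metis
  then show ?thesis using strongly_stable_nabla_ge[OF T(1,3) assms(2) _ assms(4-6)] assms(3) by simp
qed

lemma card_Delta: "card (Delta q m e S) = card (Mbar q m e) - card (nabla q m e S)"
  unfolding Delta_def by (rule card_Diff_subset) (auto simp: nabla_def intro: finite_subset[OF _ finite_Mbar])

lemma Mbar_eq_mons: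
  assumes "d < q"
  shows "Mbar q m d = mons m d"
  using mons_le[of _ m d] assms by (subst Mbar_eq) (auto intro: le_less_trans)

text \<open>Pascal's rule, splitting by divisibility by x_m.\<close>

lemma card_mons: "card (mons m d) = (m + d choose d)"
proof (induction "m + d" arbitrary: m d)
  case 0
  have "mons 0 0 = {\<lambda>_. 0}" by (auto simp: mons_def mdeg_def fun_eq_iff) (metis gr_zeroI)
  with 0 show ?case by simp
next
  case (Suc n)
  show ?case
  proof (cases m)
    case m: 0
    have "mons 0 d = {(\<lambda>_. 0)(0 := d)}"
      by (auto simp: mons_def mdeg_def fun_eq_iff)
    then show ?thesis using m by simp
  next
    case m: (Suc m')
    show ?thesis
    proof (cases d)
      case d: 0
      have "mons m 0 = {\<lambda>_. 0}" 
      proof -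
        have "a = (\<lambda>_. 0)" if "a \<in> mons m 0" for a using mons_le[OF that] by auto
        moreover have "(\<lambda>_. 0) \<in> mons m 0" by (simp add: mons_def mdeg_def)
        ultimately show ?thesis by blast
      qed
      then show ?thesis using d by simp
    next
      case d: (Suc d')
      have "card {a\<in>mons m d. Suc 0 \<le> a m} = card (colon_last m d' (mons m d))"
        using card_last_ge[of "mons m d" m d' 0] d by simp
      also have "colon_last m d' (mons m d) = mons m d'"
        using mons_mult[of _ m d' m] d by (auto simp: colon_last_def mult_last_def)
      finally have c1: "card {a\<in>mons m d. Suc 0 \<le> a m} = card (mons m d')" .
      have c2: "{a\<in>mons m d. a m = 0} = mons m' d" using mons_Suc_zero[of m' d] m by simp
      have "mons m d = {a\<in>mons m d. Suc 0 \<le> a m} \<union> {a\<in>mons m d. a m = 0}" by auto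
      then have "card (mons m d) = card {a\<in>mons m d. Suc 0 \<le> a m} + card {a\<in>mons m d. a m = 0}"
        using card_Un_disjoint[of "{a\<in>mons m d. Suc 0 \<le> a m}" "{a\<in>mons m d. a m = 0}"] finite_mons[of m d]
        by (simp add: disjoint_iff)
      then show ?thesis using c1 c2 Suc.hyps(1)[of m d'] Suc.hyps(1)[of m' d] Suc.hyps(2) m d by simp
    qed
  qed
qed

section \<open>Evaluation of monomials over a finite field\<close>

text \<open>Multiplication by x permutes the nonzero elements, so their product is
  unchanged.\<close>

lemma finite_field_power_card_minus_1:
  fixes x :: "'a::{finite,field}"
  assumes "x \<noteq> 0"
  shows "x ^ (card (UNIV :: 'a set) - 1) = 1"
proof -
  let ?U = "UNIV - {0 :: 'a}"
  have "bij_betw ((*) x) ?U ?U"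
    by (rule bij_betw_byWitness[where f' = "(*) (inverse x)"]) (use assms in auto)
  then have "(\<Prod>y\<in>?U. x * y) = \<Prod>?U" by (rule prod.reindex_bij_betw)
  moreover have "(\<Prod>y\<in>?U. x * y) = x ^ card ?U * \<Prod>?U" by (simp add: prod.distrib)
  moreover have "\<Prod>?U \<noteq> 0" by simp
  ultimately have "x ^ card ?U = 1" by simp
  then show ?thesis by (simp add: card_Diff_subset)
qed

lemma finite_field_card_gt_1: "1 < card (UNIV :: 'a::{finite,field} set)"
proof -
  have "card {0, 1 :: 'a} \<le> card (UNIV :: 'a set)" by (rule card_mono) auto
  then show ?thesis by simp
qed

text \<open>Requiring n >= q, not just n >= q - 1, keeps the new exponent positive, so x = 0 is
  covered.\<close>

lemma finite_field_power_reduce: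
  fixes x :: "'a::{finite,field}"
  assumes "card (UNIV :: 'a set) \<le> n"
  shows "x ^ n = x ^ (n - (card (UNIV :: 'a set) - 1))"
proof (cases "x = 0")
  case True
  then show ?thesis using assms finite_field_card_gt_1[where 'a = 'a] by (simp add: power_0_left)
next
  case False
  have "x ^ n = x ^ ((card (UNIV :: 'a set) - 1) + (n - (card (UNIV :: 'a set) - 1)))"
    using assms by simp
  also have "\<dots> = x ^ (n - (card (UNIV :: 'a set) - 1))"
    unfolding power_add finite_field_power_card_minus_1[OF False] by simp
  finally show ?thesis .
qed

definition mev :: "nat \<Rightarrow> (nat \<Rightarrow> nat) \<Rightarrow> (nat \<Rightarrow> 'a::field) \<Rightarrow> 'a" where
  "mev m a x = (\<Prod>i\<le>m. x i ^ a i)"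

lemma mev_add: "mev m (\<lambda>i. a i + b i) x = mev m a x * mev m b x"
  by (simp add: mev_def power_add prod.distrib)

text \<open>The relation x_j^q x_l = x_j x_l^q. Both exponents stay positive, so it also holds where
  a coordinate vanishes.\<close>

lemma mev_reduce:
  fixes x :: "nat \<Rightarrow> 'a::{finite,field}"
  assumes q: "q = card (UNIV :: 'a set)" and jl: "j < l" "l \<le> m" and a: "0 < a l" "q \<le> a j"
  shows "mev m (a(j := a j - (q - 1), l := a l + (q - 1))) x = mev m a x"
proof -
  let ?b = "a(j := a j - (q - 1), l := a l + (q - 1))"
  have split: "mev m c x = (\<Prod>i\<in>{..m}-{j,l}. x i ^ c i) * (x j ^ c j * x l ^ c l)" for c
  proof -
    have "(\<Prod>i\<le>m. x i ^ c i) = (\<Prod>i\<in>{..m}-{j,l}. x i ^ c i) * (\<Prod>i\<in>{j,l}. x i ^ c i)"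
      by (rule prod.subset_diff) (use jl in auto)
    then show ?thesis using jl by (simp add: mev_def)
  qed
  have "(\<Prod>i\<in>{..m}-{j,l}. x i ^ ?b i) = (\<Prod>i\<in>{..m}-{j,l}. x i ^ a i)"
    by (rule prod.cong) auto
  moreover have "x j ^ ?b j = x j ^ a j"
    using finite_field_power_reduce[of "a j" "x j"] q a jl by simp
  moreover have "x l ^ ?b l = x l ^ a l"
    using finite_field_power_card_minus_1[of "x l"] q a jl by (cases "x l = 0") (auto simp: power_add)
  ultimately show ?thesis by (simp only: split)
qed

text \<open>Equality is asked on Z only, which is how reduction modulo polynomials vanishing on Z
  enters.\<close>

definition spanned :: "nat \<Rightarrow> (nat \<Rightarrow> nat) set \<Rightarrow> (nat \<Rightarrow> 'a::field) set \<Rightarrow> ((nat \<Rightarrow> 'a) \<Rightarrow> 'a) \<Rightarrow> bool" where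
  "spanned m A Z f \<longleftrightarrow> (\<exists>c. \<forall>x\<in>Z. f x = (\<Sum>a\<in>A. c a * mev m a x))"

lemma spanned_cong: "(\<And>x. x \<in> Z \<Longrightarrow> f x = g x) \<Longrightarrow> spanned m A Z g \<Longrightarrow> spanned m A Z f"
  by (auto simp: spanned_def)

lemma spanned_zero: "spanned m A Z (\<lambda>x. 0)"
  unfolding spanned_def by (rule exI[of _ "\<lambda>_. 0"]) simp

lemma spanned_add: "spanned m A Z f \<Longrightarrow> spanned m A Z g \<Longrightarrow> spanned m A Z (\<lambda>x. f x + g x)"
  unfolding spanned_def
proof (elim exE)
  fix c c' assume "\<forall>x\<in>Z. f x = (\<Sum>a\<in>A. c a * mev m a x)" "\<forall>x\<in>Z. g x = (\<Sum>a\<in>A. c' a * mev m a x)"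
  then show "\<exists>c. \<forall>x\<in>Z. f x + g x = (\<Sum>a\<in>A. c a * mev m a x)"
    by (intro exI[of _ "\<lambda>a. c a + c' a"]) (simp add: distrib_right sum.distrib)
qed

lemma spanned_scale: "spanned m A Z f \<Longrightarrow> spanned m A Z (\<lambda>x. k * f x)"
  unfolding spanned_def
proof (elim exE)
  fix c assume "\<forall>x\<in>Z. f x = (\<Sum>a\<in>A. c a * mev m a x)"
  then show "\<exists>c. \<forall>x\<in>Z. k * f x = (\<Sum>a\<in>A. c a * mev m a x)"
    by (intro exI[of _ "\<lambda>a. k * c a"]) (simp add: sum_distrib_left mult.assoc)
qed

lemma spanned_sum:
  "(\<And>i. i \<in> I \<Longrightarrow> spanned m A Z (f i)) \<Longrightarrow> spanned m A Z (\<lambda>x. \<Sum>i\<in>I. f i x)"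
  by (induction I rule: infinite_finite_induct) (simp_all add: spanned_zero spanned_add)

lemma spanned_mev:
  assumes "finite A" "a \<in> A"
  shows "spanned m A Z (mev m a)"
  unfolding spanned_def
proof (intro exI[of _ "\<lambda>b. of_bool (b = a)"] ballI)
  fix x
  have "(\<Sum>b\<in>A. of_bool (b = a) * mev m b x) = (\<Sum>b\<in>A. if b = a then mev m b x else 0)"
    by (rule sum.cong) auto
  then show "mev m a x = (\<Sum>b\<in>A. of_bool (b = a) * mev m b x)" using assms by simp
qed

lemma spanned_trans:
  assumes "spanned m B Z f" "\<And>a. a \<in> B \<Longrightarrow> spanned m A Z (mev m a)"
  shows "spanned m A Z f"
proof -
  obtain c where c: "\<forall>x\<in>Z. f x = (\<Sum>a\<in>B. c a * mev m a x)" using assms(1) by (auto simp: spanned_def)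
  show ?thesis
    by (rule spanned_cong[of _ _ "\<lambda>x. \<Sum>a\<in>B. c a * mev m a x"])
      (use c assms(2) in \<open>auto intro!: spanned_sum spanned_scale\<close>)
qed

lemma spanned_subset: "spanned m A Z f \<Longrightarrow> Y \<subseteq> Z \<Longrightarrow> spanned m A Y f"
  by (auto simp: spanned_def)

lemma mons_add:
  assumes "a \<in> mons m d" "b \<in> mons m e"
  shows "(\<lambda>i. a i + b i) \<in> mons m (d + e)"
  using assms by (auto simp: mons_def mdeg_def sum.distrib)

lemma spanned_mult:
  assumes "spanned m (mons m d) Z f" "spanned m (mons m e) Z g"
  shows "spanned m (mons m (d + e)) Z (\<lambda>x. f x * g x)"
proof -
  obtain c where c: "\<forall>x\<in>Z. f x = (\<Sum>a\<in>mons m d. c a * mev m a x)" using assms by (auto simp: spanned_def)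
  obtain c' where c': "\<forall>x\<in>Z. g x = (\<Sum>a\<in>mons m e. c' a * mev m a x)" using assms by (auto simp: spanned_def)
  have "f x * g x = (\<Sum>a\<in>mons m d. \<Sum>b\<in>mons m e. (c a * c' b) * mev m (\<lambda>i. a i + b i) x)" if "x \<in> Z" for x
  proof -
    have "f x * g x = (\<Sum>a\<in>mons m d. \<Sum>b\<in>mons m e. (c a * mev m a x) * (c' b * mev m b x))"
      unfolding bspec[OF c that] bspec[OF c' that] by (rule sum_product)
    then show ?thesis by (simp add: mev_add mult_ac)
  qed
  then show ?thesis
    by (rule spanned_cong) (auto intro!: spanned_sum spanned_scale spanned_mev finite_mons mons_add)
qed

lemma spanned_one: "spanned m (mons m 0) Z (\<lambda>x. 1)"
proof (rule spanned_cong[of _ _ "mev m (\<lambda>_. 0)"])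
  show "spanned m (mons m 0) Z (mev m (\<lambda>_. 0))"
    by (rule spanned_mev[OF finite_mons]) (simp add: mons_def mdeg_def)
qed (simp add: mev_def)

lemma spanned_var:
  assumes "k \<le> m"
  shows "spanned m (mons m 1) Z (\<lambda>x. x k)"
proof (rule spanned_cong[of _ _ "mev m (\<lambda>i. of_bool (i = k))"])
  show "spanned m (mons m 1) Z (mev m (\<lambda>i. of_bool (i = k)))"
    using assms by (intro spanned_mev[OF finite_mons]) (auto simp: mons_def mdeg_def)
  fix x :: "nat \<Rightarrow> 'a"
  have "mev m (\<lambda>i. of_bool (i = k)) x = (\<Prod>i\<le>m. if i = k then x i else 1)"
    unfolding mev_def by (rule prod.cong) auto
  then show "x k = mev m (\<lambda>i. of_bool (i = k)) x" using assms by simp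
qed

lemma spanned_power:
  "spanned m (mons m d) Z f \<Longrightarrow> spanned m (mons m (n * d)) Z (\<lambda>x. f x ^ n)"
  by (induction n) (simp_all add: spanned_one spanned_mult)

lemma spanned_prod:
  "finite I \<Longrightarrow> (\<And>i. i \<in> I \<Longrightarrow> spanned m (mons m d) Z (f i)) \<Longrightarrow>
    spanned m (mons m (card I * d)) Z (\<lambda>x. \<Prod>i\<in>I. f i x)"
  by (induction I rule: finite_induct) (simp_all add: spanned_one spanned_mult)

lemma spanned_diff:
  assumes "spanned m A Z f" "spanned m A Z g"
  shows "spanned m A Z (\<lambda>x. f x - g x)"
  using spanned_add[OF assms(1) spanned_scale[OF assms(2), of "-1"]] by simp

text \<open>For x_k nonzero, x_k^(q-1) - (x_i - t_i x_k)^(q-1) is the indicator of x_i = t_i x_k. A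
  positive power of x_k excludes x_k = 0 and raises the degree from m(q-1) to e.\<close>

lemma separating_form:
  fixes P :: "nat \<Rightarrow> 'a::{finite,field}"
  assumes q: "q = card (UNIV :: 'a set)" and e: "m * q < e" and k: "k \<le> m" "P k \<noteq> 0"
  obtains f where "spanned m (mons m e) UNIV f" "f P \<noteq> 0"
    "\<And>x. f x \<noteq> 0 \<Longrightarrow> \<exists>c. c \<noteq> 0 \<and> (\<forall>i\<le>m. x i = c * P i)"
proof -
  define t where "t = (\<lambda>i. P i / P k)"
  let ?I = "{..m} - {k}"
  define h where "h = (\<lambda>i (x :: nat \<Rightarrow> 'a). x k ^ (q - 1) - (x i - t i * x k) ^ (q - 1))"
  define f where "f = (\<lambda>x :: nat \<Rightarrow> 'a. x k ^ (e - m * (q - 1)) * (\<Prod>i\<in>?I. h i x))"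
  have q1: "1 < q" using finite_field_card_gt_1[where 'a = 'a] q by simp
  have pow: "y ^ (q - 1) = of_bool (y \<noteq> 0)" for y :: 'a
    using finite_field_power_card_minus_1[of y] q1 q by (auto simp: power_0_left)
  have "m * (q - 1) \<le> m * q" by simp
  then have pos: "m * (q - 1) < e" using e by (rule le_less_trans)
  have h: "spanned m (mons m (q - 1)) UNIV (h i)" if "i \<in> ?I" for i
  proof -
    have v: "spanned m (mons m 1) UNIV (\<lambda>x :: nat \<Rightarrow> 'a. x i - t i * x k)"
      using that k by (intro spanned_diff spanned_scale spanned_var) auto
    have w: "spanned m (mons m 1) UNIV (\<lambda>x :: nat \<Rightarrow> 'a. x k)" by (rule spanned_var[OF k(1)])
    show ?thesis unfolding h_def
      using spanned_power[OF w, of "q - 1"] spanned_power[OF v, of "q - 1"]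
      by (intro spanned_diff) simp_all
  qed
  have "card ?I = m" using k by simp
  then have "spanned m (mons m (m * (q - 1))) UNIV (\<lambda>x. \<Prod>i\<in>?I. h i x)"
    using spanned_prod[of ?I m "q - 1" UNIV h] h by simp
  then have "spanned m (mons m ((e - m * (q - 1)) * 1 + m * (q - 1))) UNIV f"
    unfolding f_def by (rule spanned_mult[OF spanned_power[OF spanned_var[OF k(1)]]])
  then have "spanned m (mons m e) UNIV f" using pos by simp
  moreover have "f P \<noteq> 0" using k q1 by (simp add: f_def h_def t_def pow del: One_nat_def)
  moreover have "\<exists>c. c \<noteq> 0 \<and> (\<forall>i\<le>m. x i = c * P i)" if "f x \<noteq> 0" for x
  proof -
    have xk: "x k \<noteq> 0" using that pos by (auto simp: f_def power_0_left)
    have "x i = x k / P k * P i" if "i \<le> m" for i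
    proof (cases "i = k")
      case False
      then have "h i x \<noteq> 0" using \<open>f x \<noteq> 0\<close> that by (auto simp: f_def)
      then have "x i = t i * x k" using xk by (auto simp: h_def pow simp del: One_nat_def)
      then show ?thesis by (simp add: t_def)
    qed (use k in simp)
    moreover have "x k / P k \<noteq> 0" using xk k by simp
    ultimately show ?thesis by blast
  qed
  ultimately show ?thesis using that by blast
qed

section \<open>The footprint bound\<close>

lemma lex_greatest_exists:
  assumes "finite A" "A \<noteq> {}"
  shows "\<exists>a\<in>A. \<forall>b\<in>A. b = a \<or> lex_less b a"
proof -
  have "0 \<in> {..<card A}" using assms by (simp add: card_gt_0_iff)
  then obtain a where a: "a \<in> A" "card {b\<in>A. lex_less a b} = 0"
    using lex_rank_bij[OF assms(1)] unfolding bij_betw_def by (metis (no_types, lifting) imageE)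
  then have "b = a \<or> lex_less b a" if "b \<in> A" for b
    using that assms lex_less_total[of a b] by auto
  with a show ?thesis by blast
qed

text \<open>Each division step replaces \<mu> by lexicographically smaller monomials of the same
  degree. There are finitely many of these, so induction on the number of monomials below \<mu>
  applies.\<close>

lemma Delta_spans:
  fixes Z :: "(nat \<Rightarrow> 'a::{finite,field}) set"
  assumes q: "q = card (UNIV :: 'a set)" and S: "S \<subseteq> mons m d"
    and g: "\<And>\<nu>. \<nu> \<in> S \<Longrightarrow> \<exists>g. g \<nu> \<noteq> 0 \<and> (\<forall>a. g a \<noteq> 0 \<longrightarrow> a = \<nu> \<or> lex_less a \<nu>)
      \<and> (\<forall>x\<in>Z. (\<Sum>a\<in>mons m d. g a * mev m a x) = 0)"
    and \<mu>: "\<mu> \<in> mons m e"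
  shows "spanned m (Delta q m e S) Z (mev m \<mu>)"
  using \<mu>
proof (induction "card {b\<in>mons m e. lex_less b \<mu>}" arbitrary: \<mu> rule: less_induct)
  case less
  have q1: "1 < q" using finite_field_card_gt_1[where 'a = 'a] q by simp
  then have q0: "0 < q" by simp
  have IH: "spanned m (Delta q m e S) Z (mev m \<mu>')" if \<mu>': "\<mu>' \<in> mons m e" "lex_less \<mu>' \<mu>" for \<mu>'
  proof (rule less.hyps[OF _ \<mu>'(1)], rule psubset_card_mono)
    have "\<mu>' \<in> {b\<in>mons m e. lex_less b \<mu>}" "\<mu>' \<notin> {b\<in>mons m e. lex_less b \<mu>'}"
      using \<mu>' lex_less_irrefl by auto
    moreover have "{b\<in>mons m e. lex_less b \<mu>'} \<subseteq> {b\<in>mons m e. lex_less b \<mu>}"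
      using \<mu>'(2) lex_less_trans by blast
    ultimately show "{b\<in>mons m e. lex_less b \<mu>'} \<subset> {b\<in>mons m e. lex_less b \<mu>}" by blast
  qed (simp add: finite_mons)
  consider "\<mu> \<in> Delta q m e S" | "\<mu> \<in> nabla q m e S" | "\<mu> \<notin> Mbar q m e" by (auto simp: Delta_def)
  then show ?case
  proof cases
    case 1
    then show ?thesis by (intro spanned_mev) (auto simp: Delta_def finite_Mbar)
  next
    case 2
    then obtain \<nu> where \<nu>: "\<nu> \<in> S" "mdvd \<nu> \<mu>" by (auto simp: nabla_def)
    have \<nu>m: "\<nu> \<in> mons m d" using \<nu> S by blast
    obtain g where g: "g \<nu> \<noteq> 0" "\<And>a. g a \<noteq> 0 \<Longrightarrow> a = \<nu> \<or> lex_less a \<nu>"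
      "\<And>x. x \<in> Z \<Longrightarrow> (\<Sum>a\<in>mons m d. g a * mev m a x) = 0" using assms(3)[OF \<nu>(1)] by blast
    define \<tau> where "\<tau> = (\<lambda>i. \<mu> i - \<nu> i)"
    have \<mu>\<tau>: "\<mu> = (\<lambda>i. \<nu> i + \<tau> i)" using \<nu>(2) by (auto simp: \<tau>_def mdvd_def)
    have deg: "mdeg m \<tau> + d = e" and \<tau>m: "\<tau> \<in> mons m (mdeg m \<tau>)"
      using \<nu>m less.prems unfolding \<mu>\<tau> by (auto simp: mons_def mdeg_def sum.distrib)
    have eq: "mev m \<mu> x = (\<Sum>a\<in>mons m d - {\<nu>}. (- g a / g \<nu>) * mev m (\<lambda>i. a i + \<tau> i) x)" if "x \<in> Z" for x
    proof -
      have "g \<nu> * mev m \<nu> x + (\<Sum>a\<in>mons m d - {\<nu>}. g a * mev m a x) = 0"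
        using g(3)[OF that] \<nu>m finite_mons by (subst (asm) sum.remove[of _ \<nu>]) auto
      then have "mev m \<nu> x = - (\<Sum>a\<in>mons m d - {\<nu>}. g a * mev m a x) / g \<nu>"
        using g(1) by (simp add: field_simps eq_neg_iff_add_eq_0)
      then have "mev m \<mu> x = - (\<Sum>a\<in>mons m d - {\<nu>}. g a * mev m a x) / g \<nu> * mev m \<tau> x"
        by (simp add: \<mu>\<tau> mev_add)
      also have "\<dots> = (\<Sum>a\<in>mons m d - {\<nu>}. (- g a / g \<nu>) * mev m (\<lambda>i. a i + \<tau> i) x)"
        unfolding sum_negf[symmetric] sum_divide_distrib sum_distrib_right
        by (rule sum.cong[OF refl]) (simp add: mev_add)
      finally show ?thesis .
    qed
    have "spanned m (Delta q m e S) Z (\<lambda>x. \<Sum>a\<in>mons m d - {\<nu>}. (- g a / g \<nu>) * mev m (\<lambda>i. a i + \<tau> i) x)"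
    proof (rule spanned_sum)
      fix a assume a: "a \<in> mons m d - {\<nu>}"
      show "spanned m (Delta q m e S) Z (\<lambda>x. (- g a / g \<nu>) * mev m (\<lambda>i. a i + \<tau> i) x)"
      proof (cases "g a = 0")
        case True then show ?thesis by (simp add: spanned_zero)
      next
        case False
        then have "lex_less a \<nu>" using g(2) a by blast
        then have "lex_less (\<lambda>i. a i + \<tau> i) \<mu>" unfolding \<mu>\<tau> lex_less_def by auto
        moreover have "(\<lambda>i. a i + \<tau> i) \<in> mons m e" using mons_add[OF _ \<tau>m, of a d] a deg by (simp add: add.commute)
        ultimately show ?thesis by (intro spanned_scale IH)
      qed
    qed
    then show ?thesis by (rule spanned_cong[OF eq, rotated])
  next
    case 3
    then obtain j l where jl: "j < l" "0 < \<mu> l" "q \<le> \<mu> j"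
      using less.prems by (auto simp: Mbar_eq[OF q0] not_less)
    have lm: "l \<le> m" using mons_pos_le[OF less.prems jl(2)] .
    let ?\<mu>' = "\<mu>(j := \<mu> j - (q - 1), l := \<mu> l + (q - 1))"
    have "(\<Sum>i\<in>{..m}-{j,l}. ?\<mu>' i) = (\<Sum>i\<in>{..m}-{j,l}. \<mu> i)" by (rule sum.cong) auto
    moreover have "(\<Sum>i\<le>m. c i) = (\<Sum>i\<in>{..m}-{j,l}. c i) + (c j + c l)" for c :: "nat \<Rightarrow> nat"
      using sum.subset_diff[of "{j,l}" "{..m}" c] jl lm by simp
    ultimately have "?\<mu>' \<in> mons m e" using less.prems jl lm by (auto simp: mons_def mdeg_def)
    moreover have "lex_less ?\<mu>' \<mu>"
      using jl q1 by (auto simp: lex_less_def intro!: exI[of _ j])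
    ultimately have "spanned m (Delta q m e S) Z (mev m ?\<mu>')" by (rule IH)
    then show ?thesis
      by (rule spanned_cong[rotated]) (simp only: mev_reduce[OF q jl(1) lm jl(2,3)])
  qed
qed

text \<open>Coefficient vectors on A map onto the functions on Z; comparing the numbers of both
  compares exponents of the field size.\<close>

lemma card_le_of_spanning:
  fixes Z :: "(nat \<Rightarrow> 'a::{finite,field}) set"
  assumes "finite Z" "finite A" "\<And>g. spanned m A Z g"
  shows "card Z \<le> card A"
proof -
  let ?F = "\<lambda>c :: (nat \<Rightarrow> nat) \<Rightarrow> 'a. restrict (\<lambda>x. \<Sum>a\<in>A. c a * mev m a x) Z"
  let ?U = "UNIV :: 'a set"
  have "(Z \<rightarrow>\<^sub>E ?U) \<subseteq> ?F ` (A \<rightarrow>\<^sub>E ?U)"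
  proof
    fix g assume g: "g \<in> Z \<rightarrow>\<^sub>E ?U"
    obtain c where c: "\<forall>x\<in>Z. g x = (\<Sum>a\<in>A. c a * mev m a x)"
      using assms(3)[of g] by (auto simp: spanned_def)
    have "g = ?F (restrict c A)"
    proof
      fix x show "g x = ?F (restrict c A) x"
        using c PiE_arb[OF g, of x] by (cases "x \<in> Z") simp_all
    qed
    moreover have "restrict c A \<in> A \<rightarrow>\<^sub>E ?U" by simp
    ultimately show "g \<in> ?F ` (A \<rightarrow>\<^sub>E ?U)" by (rule image_eqI)
  qed
  then have "card (Z \<rightarrow>\<^sub>E ?U) \<le> card (A \<rightarrow>\<^sub>E ?U)"
    using assms by (intro surj_card_le) (auto intro: finite_PiE)
  then have "card ?U ^ card Z \<le> card ?U ^ card A" using assms by (simp add: card_funcsetE)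
  then show ?thesis using finite_field_card_gt_1[where 'a = 'a] by (simp add: power_increasing_iff)
qed

text \<open>A nonzero combination is nonzero at its own leading monomial, so a combination is
  determined by its coefficients on the set of all leading monomials. By independence the
  coefficient vectors c inject into functions on that set.\<close>

lemma leading_monomials:
  fixes G :: "nat \<Rightarrow> (nat \<Rightarrow> nat) \<Rightarrow> 'a::{finite,field}"
  assumes adm: "admissible_family q m d r G" and d: "d < q"
  obtains S where "S \<subseteq> mons m d" "card S = r"
    "\<And>\<nu>. \<nu> \<in> S \<Longrightarrow> \<exists>c. (\<Sum>j<r. c j * G j \<nu>) \<noteq> 0
      \<and> (\<forall>a. (\<Sum>j<r. c j * G j a) \<noteq> 0 \<longrightarrow> a = \<nu> \<or> lex_less a \<nu>)"
proof -
  let ?V = "\<lambda>c :: nat \<Rightarrow> 'a. \<lambda>a. \<Sum>j<r. c j * G j a"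
  let ?U = "UNIV :: 'a set"
  define S where "S = {\<nu>\<in>mons m d. \<exists>c. ?V c \<nu> \<noteq> 0 \<and> (\<forall>a. ?V c a \<noteq> 0 \<longrightarrow> a = \<nu> \<or> lex_less a \<nu>)}"
  have Sm: "S \<subseteq> mons m d" by (auto simp: S_def)
  have finS: "finite S" using finite_mons_subset[OF Sm] .
  have supp: "?V c a = 0" if "a \<notin> mons m d" for c a
    using adm that by (auto simp: admissible_family_def Mbar_eq_mons[OF d])
  have indep: "\<forall>j<r. c j = 0" if "\<forall>a. ?V c a = 0" for c
    using adm that by (auto simp: admissible_family_def)
  have zero: "\<forall>a. ?V c a = 0" if z: "\<And>a. a \<in> S \<Longrightarrow> ?V c a = 0" for c
  proof (rule ccontr)
    assume "\<not> ?thesis"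
    then have ne: "{a\<in>mons m d. ?V c a \<noteq> 0} \<noteq> {}" using supp by blast
    have "finite {a\<in>mons m d. ?V c a \<noteq> 0}" using finite_mons by simp
    from lex_greatest_exists[OF this ne] obtain \<nu> where \<nu>: "\<nu> \<in> mons m d" "?V c \<nu> \<noteq> 0"
      and max: "\<forall>b\<in>{a\<in>mons m d. ?V c a \<noteq> 0}. b = \<nu> \<or> lex_less b \<nu>"
      by auto
    have "b = \<nu> \<or> lex_less b \<nu>" if "?V c b \<noteq> 0" for b
      using max supp[of b c] that by blast
    then have "\<nu> \<in> S" unfolding S_def using \<nu> by blast
    then show False using z \<nu>(2) by blast
  qed
  have "inj_on (\<lambda>c. restrict (?V c) S) ({..<r} \<rightarrow>\<^sub>E ?U)"
  proof (rule inj_onI)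
    fix c c' assume c: "c \<in> {..<r} \<rightarrow>\<^sub>E ?U" "c' \<in> {..<r} \<rightarrow>\<^sub>E ?U" and eq: "restrict (?V c) S = restrict (?V c') S"
    have "?V (\<lambda>j. c j - c' j) a = 0" if "a \<in> S" for a
      using fun_cong[OF eq, of a] that by (simp add: left_diff_distrib sum_subtractf)
    then have "\<forall>j<r. c j - c' j = 0" by (rule indep[OF zero])
    then show "c = c'" using c by (intro PiE_ext) auto
  qed
  then have "card ({..<r} \<rightarrow>\<^sub>E ?U) \<le> card (S \<rightarrow>\<^sub>E ?U)"
  proof (rule card_inj_on_le)
    show "(\<lambda>c. restrict (?V c) S) ` ({..<r} \<rightarrow>\<^sub>E ?U) \<subseteq> S \<rightarrow>\<^sub>E ?U"
      by (intro image_subsetI) simp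
    show "finite (S \<rightarrow>\<^sub>E ?U)" by (rule finite_PiE[OF finS]) simp
  qed
  then have "card ?U ^ r \<le> card ?U ^ card S" using finS by (simp add: card_funcsetE)
  then have "r \<le> card S" using finite_field_card_gt_1[where 'a = 'a] by (simp add: power_increasing_iff)
  then obtain S' where "S' \<subseteq> S" "card S' = r" using finS by (meson obtain_subset_with_card_n)
  with that[of S'] Sm show ?thesis by (auto simp: S_def)
qed

section \<open>Projective points and common zeros\<close>

lemma proj_point_rep:
  assumes "P \<in> proj_points m" "y \<in> P"
  shows "P = {(\<lambda>i. c * y i) | c. c \<noteq> 0}" "\<forall>i>m. y i = 0" "\<exists>i\<le>m. y i \<noteq> 0"
proof -
  obtain x where x: "P = {(\<lambda>i. c * x i) | c. c \<noteq> 0}" "\<forall>i>m. x i = 0" "\<exists>i\<le>m. x i \<noteq> 0"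
    using assms(1) by (auto simp: proj_points_def)
  obtain b where b: "b \<noteq> 0" "y = (\<lambda>i. b * x i)" using x(1) assms(2) by auto
  show "\<forall>i>m. y i = 0" "\<exists>i\<le>m. y i \<noteq> 0" using x b by auto
  show "P = {(\<lambda>i. c * y i) | c. c \<noteq> 0}"
  proof (intro equalityI subsetI)
    fix z assume "z \<in> P"
    then obtain c where c: "c \<noteq> 0" "z = (\<lambda>i. c * x i)" using x(1) by blast
    then have "z = (\<lambda>i. (c / b) * y i)" "c / b \<noteq> 0" using b by auto
    then show "z \<in> {(\<lambda>i. c * y i) | c. c \<noteq> 0}" by blast
  next
    fix z assume "z \<in> {(\<lambda>i. c * y i) | c. c \<noteq> 0}"
    then obtain c where c: "c \<noteq> 0" "z = (\<lambda>i. c * y i)" by blast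
    then have "z = (\<lambda>i. (c * b) * x i)" "c * b \<noteq> 0" using b by auto
    then show "z \<in> P" unfolding x(1) by blast
  qed
qed

lemma card_common_zeros_le:
  fixes G :: "nat \<Rightarrow> (nat \<Rightarrow> nat) \<Rightarrow> 'a::{finite,field}"
  assumes q: "q = card (UNIV :: 'a set)" and adm: "admissible_family q m d r G" and d: "d < q" and e: "m * q < e"
  obtains S where "S \<subseteq> mons m d" "card S = r" "card (common_zeros q m d r G) \<le> card (Delta q m e S)"
proof -
  obtain S where S: "S \<subseteq> mons m d" "card S = r"
    and lead: "\<And>\<nu>. \<nu> \<in> S \<Longrightarrow> \<exists>c. (\<Sum>j<r. c j * G j \<nu>) \<noteq> 0
      \<and> (\<forall>a. (\<Sum>j<r. c j * G j a) \<noteq> 0 \<longrightarrow> a = \<nu> \<or> lex_less a \<nu>)"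
    by (rule leading_monomials[OF adm d]) blast
  define rep where "rep = (\<lambda>P :: (nat \<Rightarrow> 'a) set. SOME x. x \<in> P)"
  define Z where "Z = rep ` common_zeros q m d r G"
  have repP: "rep P \<in> P" if "P \<in> proj_points m" for P
  proof -
    have "P \<noteq> {}" using that by (auto simp: proj_points_def intro: exI[of _ 1])
    then show ?thesis unfolding rep_def by (simp add: some_in_eq)
  qed
  have cz: "P \<in> proj_points m" if "P \<in> common_zeros q m d r G" for P using that by (simp add: common_zeros_def)
  have inj: "inj_on rep (common_zeros q m d r G)"
  proof (rule inj_onI)
    fix P Q assume P: "P \<in> common_zeros q m d r G" and Q: "Q \<in> common_zeros q m d r G" and eq: "rep P = rep Q"
    show "P = Q"
      using proj_point_rep(1)[OF cz[OF P] repP[OF cz[OF P]]] proj_point_rep(1)[OF cz[OF Q] repP[OF cz[OF Q]]]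
      unfolding eq by (rule trans[OF _ sym])
  qed
  have Zsupp: "\<forall>i>m. x i = 0" "\<exists>i\<le>m. x i \<noteq> 0" if "x \<in> Z" for x
    using that proj_point_rep(2,3)[OF cz repP[OF cz]] by (auto simp: Z_def)
  \<comment> \<open>Distinct chosen representatives are never proportional, so the separating form
    of one of them vanishes at all others.\<close>
  have Zprop: "x = y" if x: "x \<in> Z" and y: "y \<in> Z" and c: "c \<noteq> 0" and xy: "\<forall>i\<le>m. x i = c * y i" for x y c
  proof -
    obtain P Q where P: "P \<in> common_zeros q m d r G" "x = rep P" and Q: "Q \<in> common_zeros q m d r G" "y = rep Q"
      using x y by (auto simp: Z_def)
    have "x i = c * y i" for i using xy Zsupp(1)[OF x] Zsupp(1)[OF y] by (cases "i \<le> m") auto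
    then have "x = (\<lambda>i. c * y i)" by blast
    then have "x \<in> Q" using proj_point_rep(1)[OF cz[OF Q(1)] repP[OF cz[OF Q(1)]]] Q(2) c by blast
    then have "P = Q"
      using proj_point_rep(1)[OF cz[OF Q(1)], of x] proj_point_rep(1)[OF cz[OF P(1)], of x] repP[OF cz[OF P(1)]] P(2)
      by simp
    then show ?thesis using P Q by simp
  qed
  have finZ: "finite Z"
  proof (rule finite_subset)
    show "Z \<subseteq> (\<lambda>f i. if i \<le> m then f i else 0) ` ({..m} \<rightarrow>\<^sub>E UNIV)"
    proof
      fix x assume x: "x \<in> Z"
      then have "x = (\<lambda>i. if i \<le> m then restrict x {..m} i else 0)"
        using Zsupp(1)[OF x] by (auto simp: fun_eq_iff)
      moreover have "restrict x {..m} \<in> {..m} \<rightarrow>\<^sub>E UNIV" by simp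
      ultimately show "x \<in> (\<lambda>f i. if i \<le> m then f i else 0) ` ({..m} \<rightarrow>\<^sub>E UNIV)" by (rule image_eqI)
    qed
  qed (auto intro!: finite_PiE)
  have vanish: "\<exists>g. g \<nu> \<noteq> 0 \<and> (\<forall>a. g a \<noteq> 0 \<longrightarrow> a = \<nu> \<or> lex_less a \<nu>)
      \<and> (\<forall>x\<in>Z. (\<Sum>a\<in>mons m d. g a * mev m a x) = 0)" if \<nu>: "\<nu> \<in> S" for \<nu>
  proof -
    obtain c where c: "(\<Sum>j<r. c j * G j \<nu>) \<noteq> 0" "\<forall>a. (\<Sum>j<r. c j * G j a) \<noteq> 0 \<longrightarrow> a = \<nu> \<or> lex_less a \<nu>"
      using lead[OF \<nu>] by blast
    have "(\<Sum>a\<in>mons m d. (\<Sum>j<r. c j * G j a) * mev m a x) = 0" if x: "x \<in> Z" for x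
    proof -
      obtain P where P: "P \<in> common_zeros q m d r G" "x = rep P" using x by (auto simp: Z_def)
      have "peval q m d (G j) x = 0" if "j < r" for j
        using P that repP[OF cz[OF P(1)]] by (auto simp: common_zeros_def)
      then have zero: "(\<Sum>a\<in>mons m d. G j a * mev m a x) = 0" if "j < r" for j
        using that by (simp add: peval_def mev_def Mbar_eq_mons[OF d])
      have "(\<Sum>a\<in>mons m d. (\<Sum>j<r. c j * G j a) * mev m a x)
          = (\<Sum>a\<in>mons m d. \<Sum>j<r. c j * (G j a * mev m a x))"
        by (simp add: sum_distrib_right mult.assoc)
      also have "\<dots> = (\<Sum>j<r. c j * (\<Sum>a\<in>mons m d. G j a * mev m a x))"
        by (subst sum.swap) (simp add: sum_distrib_left)
      also have "\<dots> = 0" using zero by simp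
      finally show ?thesis .
    qed
    with c show ?thesis by (intro exI[of _ "\<lambda>a. \<Sum>j<r. c j * G j a"]) blast
  qed
  have "spanned m (mons m e) Z g" for g :: "(nat \<Rightarrow> 'a) \<Rightarrow> 'a"
  proof -
    have "\<exists>f. spanned m (mons m e) Z f \<and> f P \<noteq> 0 \<and> (\<forall>x\<in>Z. x \<noteq> P \<longrightarrow> f x = 0)" if P: "P \<in> Z" for P
    proof -
      obtain k where "k \<le> m" "P k \<noteq> 0" using Zsupp(2)[OF P] by blast
      then obtain f where f: "spanned m (mons m e) UNIV f" "f P \<noteq> 0"
        "\<And>x. f x \<noteq> 0 \<Longrightarrow> \<exists>c. c \<noteq> 0 \<and> (\<forall>i\<le>m. x i = c * P i)"
        using separating_form[OF q e] by metis
      then show ?thesis using Zprop[OF _ P] spanned_subset[OF f(1), of Z] by blast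
    qed
    then obtain f where f: "\<And>P. P \<in> Z \<Longrightarrow> spanned m (mons m e) Z (f P)" "\<And>P. P \<in> Z \<Longrightarrow> f P P \<noteq> 0"
      "\<And>P x. P \<in> Z \<Longrightarrow> x \<in> Z \<Longrightarrow> x \<noteq> P \<Longrightarrow> f P x = 0" by metis
    \<comment> \<open>Lagrange interpolation with the separating forms: degree-e monomials span all
      functions on Z.\<close>
    have "g x = (\<Sum>P\<in>Z. (g P / f P P) * f P x)" if "x \<in> Z" for x
    proof -
      have "(\<Sum>P\<in>Z. (g P / f P P) * f P x) = (\<Sum>P\<in>Z. if P = x then g x else 0)"
        by (rule sum.cong) (use f(2,3) that in auto)
      then show ?thesis using finZ that by simp
    qed
    then show ?thesis by (rule spanned_cong) (assumption | rule spanned_sum spanned_scale f(1))+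
  qed
  then have "spanned m (Delta q m e S) Z g" for g :: "(nat \<Rightarrow> 'a) \<Rightarrow> 'a"
    using Delta_spans[OF q S(1) vanish] by (rule spanned_trans)
  then have "card Z \<le> card (Delta q m e S)"
    by (intro card_le_of_spanning[OF finZ]) (auto simp: Delta_def finite_Mbar)
  then have "card (common_zeros q m d r G) \<le> card (Delta q m e S)"
    by (simp add: Z_def card_image[OF inj])
  with S that show ?thesis by blast
qed

text \<open>Distinct monomials are independent. This makes the set under \<open>Max\<close> in
  \<open>ebar\<close> nonempty.\<close>

lemma admissible_family_exists:
  assumes "r \<le> card (mons m d)" "d < q"
  shows "\<exists>G :: nat \<Rightarrow> (nat \<Rightarrow> nat) \<Rightarrow> 'a::field. admissible_family q m d r G"
proof -
  obtain h where h: "bij_betw h {0..<card (mons m d)} (mons m d)"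
    using ex_bij_betw_nat_finite[OF finite_mons] by blast
  let ?G = "\<lambda>j a. if a = h j then 1 else (0 :: 'a)"
  have hm: "h j \<in> mons m d" if "j < r" for j using h that assms by (auto simp: bij_betw_def)
  have "c j = 0" if z: "\<forall>a. (\<Sum>k<r. c k * ?G k a) = 0" and j: "j < r" for c j
  proof -
    have "(\<Sum>k<r. c k * ?G k (h j)) = (\<Sum>k<r. if k = j then c k else 0)"
      using h j assms(1) by (intro sum.cong) (auto simp: bij_betw_def inj_on_def)
    then show ?thesis using z j by simp
  qed
  then have "admissible_family q m d r ?G"
    unfolding admissible_family_def Mbar_eq_mons[OF assms(2)] using hm by auto
  then show ?thesis by blast
qed

text \<open>Since r_d = 0 for d < q, the bound on r is the number of all monomials of degree d, and
  q is the cardinality of the field.\<close>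

theorem theorem5p7:
  fixes q m d r :: nat
  assumes "q = card (UNIV :: 'a::{finite,field} set)"
    and "1 \<le> m"
    and "1 \<le> d" and "d < q"
    and "1 \<le> r" and "r \<le> (m + d choose d)"
  shows "\<exists>e0. \<forall>e\<ge>e0.
     (\<forall>S. S \<subseteq> Mbar q m d \<and> card S = r \<longrightarrow>
          card (Delta q m e S) \<le> card (Delta q m e (lexM q m d r))) \<and>
     A_r q r d m e = card (Delta q m e (lexM q m d r)) \<and>
     ebar TYPE('a) r d m \<le> card (Delta q m e (lexM q m d r))"
\<comment> \<open>The part m*q exceeds the sum of the exponents before the last variable; the extra
  q also puts e above d.\<close>
proof (intro exI[of _ "m * q + q + 1"] allI impI)
  fix e assume "m * q + q + 1 \<le> e"
  then have e: "m * q + q < e" "m * q < e" by auto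
  have Mbar: "Mbar q m d = mons m d" by (rule Mbar_eq_mons[OF assms(4)])
  define L where "L = lexM q m d r"
  have r: "r \<le> card (mons m d)" using assms(6) by (simp add: card_mons)
  have L: "lexseg m d L" "card L = r"
    unfolding L_def lexM_def Mbar using lexseg_first card_lex_first[OF finite_mons r] by auto
  have Lm: "L \<subseteq> mons m d" using L(1) by (simp add: lexseg_def)
  have main: "card (Delta q m e S) \<le> card (Delta q m e L)" if "S \<subseteq> mons m d" "card S = r" for S
    using card_nabla_lexseg_le[OF that(1) L(1) _ assms(4) _ e(1)] that(2) L(2) assms(3)
    by (simp add: card_Delta diff_le_mono2)
  have "A_r q r d m e = card (Delta q m e L)"
    unfolding A_r_def Mbar
  proof (rule Max_eqI)
    show "finite {card (Delta q m e S) |S. S \<subseteq> mons m d \<and> card S = r}"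
      by (rule finite_subset[of _ "{..card (Delta q m e L)}"]) (use main in auto)
  qed (use main Lm L in auto)
  moreover have "ebar TYPE('a) r d m \<le> card (Delta q m e L)"
  proof -
    let ?I = "(\<lambda>G :: nat \<Rightarrow> (nat \<Rightarrow> nat) \<Rightarrow> 'a. card (common_zeros q m d r G)) ` {G. admissible_family q m d r G}"
    have bound: "n \<le> card (Delta q m e L)" if n: "n \<in> ?I" for n
    proof -
      obtain G :: "nat \<Rightarrow> (nat \<Rightarrow> nat) \<Rightarrow> 'a"
        where G: "n = card (common_zeros q m d r G)" "admissible_family q m d r G" using n by auto
      obtain S where "S \<subseteq> mons m d" "card S = r" "card (common_zeros q m d r G) \<le> card (Delta q m e S)"
        using card_common_zeros_le[OF assms(1) G(2) assms(4) e(2)] by blast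
      then show ?thesis using main[of S] G(1) by simp
    qed
    \<comment> \<open>The families themselves are infinitely many, as G is arbitrary at indices from
      r on; finiteness comes from the bound on the values.\<close>
    have "finite ?I" by (rule finite_subset[of _ "{..card (Delta q m e L)}"]) (use bound in auto)
    moreover have "?I \<noteq> {}" using admissible_family_exists[OF r assms(4), where 'a = 'a] by blast
    ultimately have "Max ?I \<le> card (Delta q m e L)" using bound by (intro Max.boundedI)
    then show ?thesis by (simp add: ebar_def assms(1))
  qed
  ultimately show "(\<forall>S. S \<subseteq> Mbar q m d \<and> card S = r \<longrightarrow>
          card (Delta q m e S) \<le> card (Delta q m e (lexM q m d r))) \<and>
     A_r q r d m e = card (Delta q m e (lexM q m d r)) \<and>
     ebar TYPE('a) r d m \<le> card (Delta q m e (lexM q m d r))"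
    using main by (simp add: Mbar L_def)
qed

end
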